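(* Let $n\geq 8$ and $m\geq 4$ be integers with $n\equiv 2 \pmod 6$. Let $G_{n,m}$ be the graph consisting of a cycle $C_n$ with vertices $u_1,\dots,u_n$ (edges $u_iu_{i+1}$ for $1\le i<n$ and $u_nu_1$), a complete graph $K_m$ with vertex set $\{w_1,w_2,v_1,\dots,v_{m-2}\}$, and the additional edges $u_1w_1$, $u_1w_2$, $u_5w_1$, $u_5w_2$. Then $\gamma_g^t(G_{n,m}) = \frac{2n-1}{3}+2$ and $\gamma_g^t(G_{n,m}|w_1) = \frac{2n-1}{3}$.
   Context: The total domination game on a graph $G$ in which a set $S\subseteq V(G)$ is predominated: two players, Dominator and Staller, alternately choose vertices of $G$. A vertex $w$ is totally dominated if it lies in $S$ or if some neighbor of $w$ has already been chosen (a vertex does not totally dominate itself). A vertex may be chosen only if it has at least one neighbor that is not yet totally dominated. The game ends when no legal move remains. Dominator aims to minimize and Staller to maximize the total number of moves. $\gamma_g^t(G|S)$ is the number of moves when Dominator starts and both play optimally; $\gamma_g^t(G)=\gamma_g^t(G|\emptyset)$ and $\gamma_g^t(G|v)=\gamma_g^t(G|\{v\})$. *)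

theory Defs
  imports Complex_Main "HOL-Number_Theory.Cong"
begin

record 'a ugraph =
  verts :: "'a set"
  edges :: "'a set set"

definition simple_graph :: "'a ugraph \<Rightarrow> bool" where
  "simple_graph G \<longleftrightarrow> finite (verts G) \<and> (\<forall>e\<in>edges G. e \<subseteq> verts G \<and> card e = 2)"

definition neighbors :: "'a ugraph \<Rightarrow> 'a \<Rightarrow> 'a set" where
  "neighbors G v = {w \<in> verts G. {v, w} \<in> edges G}"

text \<open>In the following, \<open>S\<close> is the predominated set and \<open>C\<close> is the set of vertices chosen so far.\<close>

definition totally_dominated :: "'a ugraph \<Rightarrow> 'a set \<Rightarrow> 'a set \<Rightarrow> 'a \<Rightarrow> bool" where
  "totally_dominated G S C w \<longleftrightarrow> w \<in> S \<or> (\<exists>v\<in>neighbors G w. v \<in> C)"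

definition legal_moves :: "'a ugraph \<Rightarrow> 'a set \<Rightarrow> 'a set \<Rightarrow> 'a set" where
  "legal_moves G S C = {v \<in> verts G. \<exists>w\<in>neighbors G v. \<not> totally_dominated G S C w}"

lemma legal_moves_subset: "legal_moves G S C \<subseteq> verts G"
  by (auto simp: legal_moves_def)

lemma legal_move_not_chosen: "v \<in> legal_moves G S C \<Longrightarrow> v \<notin> C"
  by (auto simp: legal_moves_def totally_dominated_def neighbors_def insert_commute)

lemma card_unchosen_less:
  assumes "finite (verts G)" "v \<in> legal_moves G S C"
  shows "card (verts G - insert v C) < card (verts G - C)"
proof (rule psubset_card_mono)
  show "finite (verts G - C)" using assms(1) by simp
  show "verts G - insert v C \<subset> verts G - C"
    using assms(2) legal_moves_subset[of G S C] legal_move_not_chosen[of v G S C] by blast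
qed

datatype player = Dominator | Staller

fun opponent :: "player \<Rightarrow> player" where
  "opponent Dominator = Staller"
| "opponent Staller = Dominator"

text \<open>
  The number of moves still to be made under optimal play when \<open>p\<close> is to move.  The finiteness
  test only serves termination: the value 0 for infinite graphs is a dummy.
\<close>

function remaining_moves :: "'a ugraph \<Rightarrow> 'a set \<Rightarrow> player \<Rightarrow> 'a set \<Rightarrow> nat" where
  "remaining_moves G S p C =
     (if finite (verts G) \<and> legal_moves G S C \<noteq> {} then
        (case p of
           Dominator \<Rightarrow>
             1 + Min ((\<lambda>v. remaining_moves G S (opponent p) (insert v C)) ` legal_moves G S C)
         | Staller \<Rightarrow>
             1 + Max ((\<lambda>v. remaining_moves G S (opponent p) (insert v C)) ` legal_moves G S C))
      else 0)"
  by pat_completeness auto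
termination
proof (relation "measure (\<lambda>(G, S, p, C). card (verts G - C))", goal_cases)
  case 1
  show ?case by simp
next
  case (2 G S p C v)
  then show ?case by (simp add: card_unchosen_less del: Diff_insert card_Diff_insert)
next
  case (3 G S p C v)
  then show ?case by (simp add: card_unchosen_less del: Diff_insert card_Diff_insert)
qed

declare remaining_moves.simps [simp del]

definition game_total_domination_number :: "'a ugraph \<Rightarrow> 'a set \<Rightarrow> nat" where
  "game_total_domination_number G S = remaining_moves G S Dominator {}"

datatype vertex = U nat | W nat | V nat

definition clique_verts :: "nat \<Rightarrow> vertex set" where
  "clique_verts m = {W 1, W 2} \<union> V ` {1..m - 2}"

definition cycle_clique_graph :: "nat \<Rightarrow> nat \<Rightarrow> vertex ugraph" where
  "cycle_clique_graph n m =
     \<lparr> verts = U ` {1..n} \<union> clique_verts m,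
       edges = {{U i, U (i + 1)} | i. 1 \<le> i \<and> i < n} \<union> {{U n, U 1}}
             \<union> {{x, y} | x y. x \<in> clique_verts m \<and> y \<in> clique_verts m \<and> x \<noteq> y}
             \<union> {{U 1, W 1}, {U 1, W 2}, {U 5, W 1}, {U 5, W 2}} \<rparr>"

lemma simple_graph_cycle_clique_graph:
  assumes "n \<ge> 5"
  shows "simple_graph (cycle_clique_graph n m)"
  using assms
  by (auto simp: simple_graph_def cycle_clique_graph_def clique_verts_def card_insert_if)

end

theory Submission
  imports Defs
begin

text \<open>
  Only the set of vertices that are not yet totally dominated matters, so the game is a covering
  game whose moves are the open neighborhoods.  Write \<open>n = 6 t + 2\<close>.  On the cycle the open
  neighborhoods are the pairs \<open>u\<^sub>i, u\<^sub>i\<^sub>+\<^sub>2\<close>, which form two cycles of length \<open>3 t + 1\<close>, and \<open>w\<^sub>1\<close> and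
  \<open>w\<^sub>2\<close> additionally offer the pair \<open>u\<^sub>1, u\<^sub>5\<close> at distance two on the odd one.  Predominating one
  vertex lowers the value by at most 2, so it suffices to show that the game on \<open>G\<close> lasts at least
  \<open>4 t + 3\<close> moves and the game on \<open>G|w\<^sub>1\<close> at most \<open>4 t + 1\<close>.

  For the upper bound Dominator opens with \<open>w\<^sub>1\<close> and then answers every move of Staller inside the
  same block of a partition of the remaining vertices into blocks that two moves exhaust.

  For the lower bound Staller makes sure that the clique takes two moves.  The rest is a game on runs
  of undominated vertices whose value depends only on the run lengths modulo 3, together with at most
  one untouched cycle, where having to move first is a disadvantage.
\<close>

section \<open>Covering games\<close>

text \<open>\<open>A\<close> holds the points still to be covered. Moves are sets, so vertices with
  equal neighborhoods are merged; this is harmless because they lead to the same position.\<close>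

function cover_game :: "'a set set \<Rightarrow> player \<Rightarrow> 'a set \<Rightarrow> nat" where
  "cover_game H p A =
     (if finite H \<and> finite A \<and> (\<exists>h\<in>H. h \<inter> A \<noteq> {}) then
        (case p of
           Dominator \<Rightarrow> 1 + Min ((\<lambda>h. cover_game H Staller (A - h)) ` {h \<in> H. h \<inter> A \<noteq> {}})
         | Staller \<Rightarrow> 1 + Max ((\<lambda>h. cover_game H Dominator (A - h)) ` {h \<in> H. h \<inter> A \<noteq> {}}))
      else 0)"
  by pat_completeness auto
termination
  by (relation "measure (\<lambda>(H, p, A). card A)") (auto intro!: psubset_card_mono)

declare cover_game.simps [simp del]

text \<open>Adjacency is symmetric, so choosing \<open>v\<close> totally dominates exactly the
  members of its neighborhood, and \<open>v\<close> is legal exactly when that neighborhood meets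
  the undominated set.\<close>

lemma remaining_moves_eq_cover_game:
  assumes "finite (verts G)"
  shows "remaining_moves G S p C =
    cover_game (neighbors G ` verts G) p {w \<in> verts G. \<not> totally_dominated G S C w}"
proof (induction "card (verts G - C)" arbitrary: p C rule: less_induct)
  case less
  define U where "U C = {w \<in> verts G. \<not> totally_dominated G S C w}" for C
  let ?N = "neighbors G"
  have legal: "v \<in> legal_moves G S C \<longleftrightarrow> v \<in> verts G \<and> ?N v \<inter> U C \<noteq> {}" for v
    unfolding legal_moves_def neighbors_def U_def by blast
  have hit: "{h \<in> ?N ` verts G. h \<inter> U C \<noteq> {}} = ?N ` legal_moves G S C"
    using legal by auto
  have upd: "U (insert v C) = U C - ?N v" if "v \<in> legal_moves G S C" for v
  proof -
    have "v \<in> verts G" using that legal by simp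
    then have "v \<in> ?N w \<longleftrightarrow> w \<in> ?N v" if "w \<in> verts G" for w
      using that by (simp add: neighbors_def insert_commute)
    then show ?thesis unfolding U_def totally_dominated_def by auto
  qed
  have IH: "remaining_moves G S q (insert v C) = cover_game (?N ` verts G) q (U C - ?N v)"
    if "v \<in> legal_moves G S C" for v q
    using less[OF card_unchosen_less[OF assms that], of q] upd[OF that] unfolding U_def by argo
  have img: "(\<lambda>v. remaining_moves G S q (insert v C)) ` legal_moves G S C =
      (\<lambda>h. cover_game (?N ` verts G) q (U C - h)) ` {h \<in> ?N ` verts G. h \<inter> U C \<noteq> {}}" for q
    unfolding hit image_image using IH by (intro image_cong) auto
  have ex: "(\<exists>h\<in>?N ` verts G. h \<inter> U C \<noteq> {}) \<longleftrightarrow> legal_moves G S C \<noteq> {}"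
    using legal by auto
  have fin: "finite (?N ` verts G)" "finite (U C)" using assms by (simp_all add: U_def)
  show ?case unfolding U_def[symmetric]
    by (cases p; subst remaining_moves.simps, subst cover_game.simps)
      (simp_all only: img ex fin assms player.case opponent.simps simp_thms if_True cong: if_cong)
qed

section \<open>One-move estimates and monotonicity\<close>

locale covering =
  fixes H :: "'a set set"
  assumes finite_H: "finite H"
begin

abbreviation "valD \<equiv> cover_game H Dominator"
abbreviation "valS \<equiv> cover_game H Staller"

lemma valD_le:
  assumes "finite A" "h \<in> H" "h \<inter> A \<noteq> {}"
  shows "valD A \<le> 1 + valS (A - h)"
  by (subst cover_game.simps) (use assms finite_H in auto)

lemma valS_ge:
  assumes "finite A" "h \<in> H" "h \<inter> A \<noteq> {}"
  shows "1 + valD (A - h) \<le> valS A"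
  by (subst (2) cover_game.simps) (use assms finite_H in \<open>auto intro!: Max_ge\<close>)

lemma val_0: "(\<And>h. h \<in> H \<Longrightarrow> h \<inter> A = {}) \<Longrightarrow> cover_game H p A = 0"
  by (subst cover_game.simps) auto

lemma valD_ge:
  assumes "finite A" "h0 \<in> H" "h0 \<inter> A \<noteq> {}"
    and "\<And>h. h \<in> H \<Longrightarrow> h \<inter> A \<noteq> {} \<Longrightarrow> k \<le> 1 + valS (A - h)"
  shows "k \<le> valD A"
proof -
  let ?X = "(\<lambda>h. valS (A - h)) ` {h \<in> H. h \<inter> A \<noteq> {}}"
  have "Min ?X \<in> ?X"
    using assms finite_H by (intro Min_in) auto
  moreover have "valD A = 1 + Min ?X"
    by (subst cover_game.simps) (use assms finite_H in auto)
  ultimately obtain h where "h \<in> H" "h \<inter> A \<noteq> {}" "valD A = 1 + valS (A - h)" by auto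
  then show ?thesis using assms(4) by metis
qed

lemma valS_le:
  assumes "finite A"
    and "\<And>h. h \<in> H \<Longrightarrow> h \<inter> A \<noteq> {} \<Longrightarrow> 1 + valD (A - h) \<le> k"
  shows "valS A \<le> k"
proof (cases "\<exists>h\<in>H. h \<inter> A \<noteq> {}")
  case True
  let ?X = "(\<lambda>h. valD (A - h)) ` {h \<in> H. h \<inter> A \<noteq> {}}"
  have "Max ?X \<in> ?X"
    using True finite_H by (intro Max_in) auto
  moreover have "valS A = 1 + Max ?X"
    by (subst cover_game.simps) (use True assms finite_H in auto)
  ultimately obtain h where "h \<in> H" "h \<inter> A \<noteq> {}" "valS A = 1 + valD (A - h)" by auto
  then show ?thesis using assms(2) by metis
next
  case False
  then show ?thesis using val_0 by (metis le0)
qed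

lemma valD_opt:
  assumes "finite A" "h0 \<in> H" "h0 \<inter> A \<noteq> {}"
  obtains h where "h \<in> H" "h \<inter> A \<noteq> {}" "valD A = 1 + valS (A - h)"
proof -
  have "\<exists>h\<in>H. h \<inter> A \<noteq> {} \<and> 1 + valS (A - h) \<le> valD A"
  proof (rule ccontr)
    assume "\<not> ?thesis"
    then have "Suc (valD A) \<le> valD A"
      using assms by (intro valD_ge[OF assms]) (auto simp: not_le Suc_le_eq)
    then show False by simp
  qed
  then show ?thesis using that valD_le[OF assms(1)] by (meson le_antisym)
qed

text \<open>
  The continuation principle: if the move that is optimal for Dominator on \<open>B\<close> covers nothing of
  \<open>A\<close>, then every move on \<open>A\<close> serves him just as well.
\<close>

lemma val_mono: "finite B \<Longrightarrow> A \<subseteq> B \<Longrightarrow> cover_game H p A \<le> cover_game H p B"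
proof (induction "card B" arbitrary: A B p rule: less_induct)
  case less
  have finA: "finite A" using less finite_subset by blast
  have smaller: "cover_game H q A' \<le> cover_game H q (B - h)"
    if "h \<inter> B \<noteq> {}" "A' \<subseteq> B - h" for h A' q
    using that less by (intro less.hyps) (auto intro!: psubset_card_mono)
  show ?case
  proof (cases p)
    case Dominator
    show ?thesis
    proof (cases "\<exists>h\<in>H. h \<inter> A \<noteq> {}")
      case True
      then obtain y where y: "y \<in> H" "y \<inter> A \<noteq> {}" by blast
      then have "y \<inter> B \<noteq> {}" using less by blast
      from valD_opt[OF less(2) y(1) this] obtain x
        where x: "x \<in> H" "x \<inter> B \<noteq> {}" "valD B = 1 + valS (B - x)" .
      obtain x' where x': "x' \<in> H" "x' \<inter> A \<noteq> {}" "A - x' \<subseteq> B - x"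
      proof (cases "x \<inter> A = {}")
        case True
        with y less that[of y] show ?thesis by blast
      next
        case False
        with x less that[of x] show ?thesis by blast
      qed
      have "valD A \<le> 1 + valS (A - x')" using valD_le finA x' by blast
      also have "\<dots> \<le> valD B" using smaller x x' by simp
      finally show ?thesis using Dominator by simp
    qed (use val_0 in \<open>metis le0\<close>)
  next
    case Staller
    have "valS A \<le> valS B"
    proof (rule valS_le[OF finA])
      fix h assume h: "h \<in> H" "h \<inter> A \<noteq> {}"
      then have hB: "h \<inter> B \<noteq> {}" using less by blast
      have "A - h \<subseteq> B - h" using less by blast
      then have "1 + valD (A - h) \<le> 1 + valD (B - h)" using smaller[OF hB] by simp
      also have "\<dots> \<le> valS B" using valS_ge less h(1) hB by blast
      finally show "1 + valD (A - h) \<le> valS B" .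
    qed
    then show ?thesis using Staller by simp
  qed
qed

text \<open>A wasted move leaves \<open>A\<close> unchanged, and any legal move there does at least
  as well by \<open>val_mono\<close>. Strategies of Dominator can thus prescribe replies without
  checking their legality.\<close>

lemma valD_le_any:
  assumes "finite A" "h \<in> H"
  shows "valD A \<le> 1 + valS (A - h)"
proof (cases "h \<inter> A = {}")
  case True
  then have same: "A - h = A" by blast
  show ?thesis
  proof (cases "\<exists>x\<in>H. x \<inter> A \<noteq> {}")
    case True
    then obtain x where x: "x \<in> H" "x \<inter> A \<noteq> {}" by blast
    have "valD A \<le> 1 + valS (A - x)" using valD_le assms x by blast
    also have "\<dots> \<le> 1 + valS A" using val_mono[of A "A - x"] assms by auto
    finally show ?thesis using same by simp
  qed (use val_0 in \<open>metis le0\<close>)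
qed (use assms valD_le in blast)

lemma valD_le_Suc_valS:
  assumes "finite A"
  shows "valD A \<le> 1 + valS A"
proof (cases "H = {}")
  case True
  then show ?thesis using val_0 by simp
next
  case False
  then obtain h where "h \<in> H" by blast
  then have "valD A \<le> 1 + valS (A - h)" using assms valD_le_any by blast
  also have "\<dots> \<le> 1 + valS A" using val_mono[of A "A - h"] assms by auto
  finally show ?thesis .
qed

text \<open>Dominator imitates optimal play on \<open>A\<close>. The extra point \<open>v\<close>
  costs either one final move, if it is left over, or a move of Staller that covers it alone plus
  the loss of a turn, bounded by \<open>valD_le_Suc_valS\<close>.\<close>

lemma val_insert_le: "finite A \<Longrightarrow> cover_game H p (insert v A) \<le> cover_game H p A + 2"
proof (induction "card A" arbitrary: A p rule: less_induct)
  case less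
  let ?B = "insert v A"
  have finB: "finite ?B" using less by simp
  have step: "cover_game H q (?B - h) \<le> cover_game H q (A - h) + 2"
    if "h \<inter> A \<noteq> {}" for h q
  proof (cases "v \<in> h")
    case True
    then have "?B - h = A - h" by blast
    then show ?thesis by simp
  next
    case False
    then have "?B - h = insert v (A - h)" by blast
    moreover have "card (A - h) < card A" using that less by (auto intro!: psubset_card_mono)
    ultimately show ?thesis using less by simp
  qed
  show ?case
  proof (cases p)
    case Dominator
    have "valD ?B \<le> valD A + 2"
    proof (cases "\<exists>h\<in>H. h \<inter> A \<noteq> {}")
      case True
      then obtain h0 where "h0 \<in> H" "h0 \<inter> A \<noteq> {}" by blast
      from valD_opt[OF less(2) this] obtain h
        where h: "h \<in> H" "h \<inter> A \<noteq> {}" "valD A = 1 + valS (A - h)" .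
      have "valD ?B \<le> 1 + valS (?B - h)" using valD_le_any finB h by blast
      then show ?thesis using step[of h Staller] h by simp
    next
      case False
      show ?thesis
      proof (cases "\<exists>h\<in>H. v \<in> h")
        case True
        then obtain h where h: "h \<in> H" "v \<in> h" by blast
        have "valS (?B - h) = 0" using False h by (intro val_0) auto
        then show ?thesis using valD_le_any[OF finB h(1)] by simp
      next
        case F: False
        then have "valD ?B = 0" using False by (intro val_0) auto
        then show ?thesis by simp
      qed
    qed
    then show ?thesis using Dominator by simp
  next
    case Staller
    have "valS ?B \<le> valS A + 2"
    proof (rule valS_le[OF finB])
      fix h assume h: "h \<in> H" "h \<inter> ?B \<noteq> {}"
      show "1 + valD (?B - h) \<le> valS A + 2"
      proof (cases "h \<inter> A = {}")
        \<comment> \<open>The move of Staller gains only \<open>v\<close>: it is now Dominator's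
          turn on \<open>A\<close>, whereas Staller would be to move there in the imitated
          game.\<close>
        case True
        then have "?B - h = A" if "v \<notin> A" using h that by blast
        moreover have "?B - h = A" if "v \<in> A" using h that True by blast
        ultimately have "?B - h = A" by blast
        then show ?thesis using valD_le_Suc_valS[OF less(2)] by simp
      next
        case False
        then show ?thesis using step[of h Dominator] valS_ge[OF less(2) h(1)] by fastforce
      qed
    qed
    then show ?thesis using Staller by simp
  qed
qed

section \<open>Block strategies for Dominator\<close>

definition replyable :: "'a set \<Rightarrow> bool" where
  "replyable T \<longleftrightarrow> (\<forall>h\<in>H. h \<inter> T \<noteq> {} \<longrightarrow> (\<exists>h'\<in>H. T - h \<subseteq> h'))"

text \<open>Every move of Staller meets some block \<open>T\<close>, and one member of
  \<open>H\<close> covers what is left of it, so each block costs two moves. The blocks may overlap: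
  only their union matters.\<close>

lemma valS_le_replyable:
  "finite A \<Longrightarrow> \<forall>T\<in>set Ts. replyable T \<Longrightarrow> A \<subseteq> \<Union> (set Ts) \<Longrightarrow> valS A \<le> 2 * length Ts"
proof (induction "length Ts" arbitrary: A Ts)
  case 0
  then show ?case using val_0 by simp
next
  case (Suc m)
  show ?case
  proof (rule valS_le[OF Suc.prems(1)])
    fix h assume h: "h \<in> H" "h \<inter> A \<noteq> {}"
    then obtain T where T: "T \<in> set Ts" "h \<inter> T \<noteq> {}" using Suc.prems by blast
    then obtain h' where h': "h' \<in> H" "T - h \<subseteq> h'"
      using Suc.prems h unfolding replyable_def by blast
    obtain Xs Ys where Ts: "Ts = Xs @ T # Ys" using T split_list by metis
    have "valS (A - h - h') \<le> 2 * length (Xs @ Ys)"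
    proof (rule Suc.hyps(1))
      show "m = length (Xs @ Ys)" using Suc.hyps(2) Ts by simp
      show "A - h - h' \<subseteq> \<Union> (set (Xs @ Ys))"
        using Suc.prems(3) h'(2) unfolding Ts by auto
    qed (use Suc.prems Ts in auto)
    then show "1 + valD (A - h) \<le> 2 * length Ts"
      using valD_le_any[of "A - h" h'] Suc.prems(1) h' Ts by simp
  qed
qed

text \<open>Meant for an untouched cycle \<open>F\<close>, whose \<open>3 t + 1\<close> vertices
  cannot be partitioned into triples in advance. The blocks \<open>Fs\<close> are chosen only after
  the first move of Staller in \<open>F\<close> and the reply \<open>h'\<close>; these two moves and
  fewer than \<open>t\<close> blocks make at most \<open>2 * t\<close> moves.\<close>

lemma valS_le_replyable_plus:
  assumes F: "\<And>h. h \<in> H \<Longrightarrow> h \<inter> F \<noteq> {} \<Longrightarrow>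
      \<exists>h'\<in>H. \<exists>Fs. F - h - h' \<subseteq> \<Union> (set Fs) \<and> (\<forall>T\<in>set Fs. replyable T) \<and> length Fs < t"
  shows "finite A \<Longrightarrow> \<forall>T\<in>set Ts. replyable T \<Longrightarrow> A \<subseteq> F \<union> \<Union> (set Ts) \<Longrightarrow>
    valS A \<le> 2 * length Ts + 2 * t"
proof (induction "length Ts" arbitrary: A Ts rule: less_induct)
  case less
  show ?case
  proof (rule valS_le[OF less.prems(1)])
    fix h assume h: "h \<in> H" "h \<inter> A \<noteq> {}"
    show "1 + valD (A - h) \<le> 2 * length Ts + 2 * t"
    proof (cases "h \<inter> F = {}")
      case False
      then obtain h' Fs where h': "h' \<in> H" "F - h - h' \<subseteq> \<Union> (set Fs)"
        "\<forall>T\<in>set Fs. replyable T" "length Fs < t" using F[OF h(1)] by blast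
      have "valS (A - h - h') \<le> 2 * length (Fs @ Ts)"
        by (rule valS_le_replyable) (use less.prems h' in auto)
      then show ?thesis
        using valD_le_any[of "A - h" h'] less.prems(1) h' by simp
    next
      case True
      then obtain T where T: "T \<in> set Ts" "h \<inter> T \<noteq> {}" using less.prems h by blast
      then obtain h' where h': "h' \<in> H" "T - h \<subseteq> h'"
        using less.prems h unfolding replyable_def by blast
      obtain Xs Ys where Ts: "Ts = Xs @ T # Ys" using T split_list by metis
      have "valS (A - h - h') \<le> 2 * length (Xs @ Ys) + 2 * t"
      proof (rule less.hyps)
        show "A - h - h' \<subseteq> F \<union> \<Union> (set (Xs @ Ys))"
          using less.prems(3) h'(2) unfolding Ts by auto
      qed (use less.prems Ts in auto)
      then show ?thesis
        using valD_le_any[of "A - h" h'] less.prems(1) h' Ts by simp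
    qed
  qed
qed

end

section \<open>Lower bounds from runs of undominated vertices\<close>

text \<open>
  With \<open>F = (\<Sum>r. run_val r)\<close> and \<open>b\<close> the number of run lengths congruent to 2 modulo 3, the exact
  values of a union of runs are \<open>F + b div 2\<close> (Dominator to move) and \<open>F + (b + 1) div 2\<close>
  (Staller to move): a run of length \<open>3 q\<close>, \<open>3 q + 1\<close> contributes \<open>2 q\<close>, \<open>2 q + 1\<close> moves, and in
  a run of length \<open>3 q + 2\<close> one move is gained by whoever plays there first.
\<close>

definition run_val :: "nat \<Rightarrow> nat" where
  "run_val r = (2 * r + 1) div 3"

definition run_hot :: "nat \<Rightarrow> nat" where
  "run_hot r = (if r mod 3 = 2 then 1 else 0)"

definition runs_val :: "'a list list \<Rightarrow> nat" where
  "runs_val Ls = (\<Sum>L\<leftarrow>Ls. run_val (length L))"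

definition runs_hot :: "'a list list \<Rightarrow> nat" where
  "runs_hot Ls = (\<Sum>L\<leftarrow>Ls. run_hot (length L))"

definition boundD :: "'a list list \<Rightarrow> nat" where
  "boundD Ls = runs_val Ls + runs_hot Ls div 2"

definition boundS :: "'a list list \<Rightarrow> nat" where
  "boundS Ls = runs_val Ls + (runs_hot Ls + 1) div 2"

lemma runs_simps [simp]:
  "runs_val [] = 0" "runs_hot [] = 0"
  "runs_val (L # Ls) = run_val (length L) + runs_val Ls"
  "runs_hot (L # Ls) = run_hot (length L) + runs_hot Ls"
  "runs_val (Ls @ Ls') = runs_val Ls + runs_val Ls'"
  "runs_hot (Ls @ Ls') = runs_hot Ls + runs_hot Ls'"
  by (simp_all add: runs_val_def runs_hot_def)

lemma bound_Nil [simp]: "boundD [] = 0" "boundS [] = 0"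
  by (simp_all add: boundD_def boundS_def)

lemma run_val_3 [simp]:
  "run_val (3 * q) = 2 * q" "run_val (3 * q + 1) = 2 * q + 1" "run_val (3 * q + 2) = 2 * q + 1"
  by (simp_all add: run_val_def)

lemma run_hot_3 [simp]:
  "run_hot (3 * q) = 0" "run_hot (3 * q + 1) = 0" "run_hot (3 * q + 2) = 1"
  unfolding run_hot_def by presburger+

lemma mod3_cases:
  obtains q where "r = 3 * q" | q where "r = 3 * q + 1" | q where "(r::nat) = 3 * q + 2"
proof -
  have "r mod 3 = 0 \<or> r mod 3 = 1 \<or> r mod 3 = 2" by linarith
  then show ?thesis using that div_mult_mod_eq[of r 3] by (metis add.right_neutral mult.commute)
qed

text \<open>
  Here \<open>b\<close> and \<open>b'\<close> also count the runs that the move leaves alone.  The second conjunct serves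
  the positions where Staller replies in the clique, so that Dominator moves twice in a row.
\<close>

definition run_drop :: "nat \<Rightarrow> nat \<Rightarrow> nat \<Rightarrow> nat \<Rightarrow> bool" where
  "run_drop f b f' b' \<longleftrightarrow>
     f + b div 2 \<le> f' + (b' + 1) div 2 + 1 \<and> (odd b \<longrightarrow> f + b div 2 \<le> f' + b' div 2 + 1)"

lemma run_val_add: "run_val (3 * q + r) = 2 * q + run_val r"
proof -
  have "2 * (3 * q + r) + 1 = (2 * r + 1) + 3 * (2 * q)" by simp
  then show ?thesis unfolding run_val_def by (metis add.commute div_mult_self2 zero_neq_numeral)
qed

lemma run_hot_add: "run_hot (3 * q + r) = run_hot r"
  by (simp add: run_hot_def)

text \<open>An edge inside a run of length \<open>p + q + 2\<close> leaves runs of lengths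
  \<open>p\<close> and \<open>q\<close>. Adding 3 to a length adds 2 to \<open>run_val\<close> and
  keeps \<open>run_hot\<close>, so the nine pairs of residues decide.\<close>

lemma run_drop_pair:
  "run_drop (run_val (p + q + 2)) (run_hot (p + q + 2) + B)
     (run_val p + run_val q) (run_hot p + run_hot q + B)"
proof -
  define i j \<rho> \<sigma> where ij: "i = p div 3" "j = q div 3" "\<rho> = p mod 3" "\<sigma> = q mod 3"
  have pq: "p = 3 * i + \<rho>" "q = 3 * j + \<sigma>" by (simp_all add: ij)
  have sum: "p + q + 2 = 3 * (i + j) + (\<rho> + \<sigma> + 2)" using pq by simp
  have "\<rho> \<in> {0, 1, 2}" "\<sigma> \<in> {0, 1, 2}" by (auto simp: ij)
  then show ?thesis
    unfolding sum unfolding pq run_val_add run_hot_add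
    by (elim insertE emptyE) (simp_all add: run_drop_def run_val_def run_hot_def)
qed

lemma run_drop_single: "run_drop (run_val 1) (run_hot 1 + B) 0 B"
  by (auto simp: run_drop_def run_val_def run_hot_def)

text \<open>Here the move takes two vertices at distance two; the vertex between them survives as a
  run of length 1, which is the summand \<open>1\<close>.\<close>

lemma run_drop_gap:
  "run_drop (run_val (p + q + 3)) (run_hot (p + q + 3) + B)
     (run_val p + 1 + run_val q) (run_hot p + run_hot q + B)"
proof -
  define i j \<rho> \<sigma> where ij: "i = p div 3" "j = q div 3" "\<rho> = p mod 3" "\<sigma> = q mod 3"
  have pq: "p = 3 * i + \<rho>" "q = 3 * j + \<sigma>" by (simp_all add: ij)
  have sum: "p + q + 3 = 3 * (i + j) + (\<rho> + \<sigma> + 3)" using pq by simp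
  have "\<rho> \<in> {0, 1, 2}" "\<sigma> \<in> {0, 1, 2}" by (auto simp: ij)
  then show ?thesis
    unfolding sum unfolding pq run_val_add run_hot_add
    by (elim insertE emptyE) (simp_all add: run_drop_def run_val_def run_hot_def)
qed

section \<open>Systems of runs\<close>

definition pts :: "'a list list \<Rightarrow> 'a set" where
  "pts Ls = \<Union> (set ` set Ls)"

lemma pts_simps [simp]:
  "pts [] = {}" "pts (L # Ls) = set L \<union> pts Ls" "pts (Ls @ Ls') = pts Ls \<union> pts Ls'"
  by (auto simp: pts_def)

lemma finite_pts [simp]: "finite (pts Ls)"
  by (simp add: pts_def)

lemma distinct_concat_pts:
  "distinct (concat (Ls @ Ls')) \<longleftrightarrow>
     distinct (concat Ls) \<and> distinct (concat Ls') \<and> pts Ls \<inter> pts Ls' = {}"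
  "distinct (concat (L # Ls)) \<longleftrightarrow> distinct L \<and> distinct (concat Ls) \<and> set L \<inter> pts Ls = {}"
  by (auto simp: pts_def)

lemma runs_zero: "pts Ls = {} \<Longrightarrow> runs_val Ls = 0 \<and> runs_hot Ls = 0"
  by (induction Ls) (auto simp: run_val_def run_hot_def)

text \<open>\<open>s\<close> is the step by two along the cycle, so the edges
  \<open>{x, s x}\<close> are traces of open neighborhoods of cycle vertices, and
  \<open>{z, s (s z)}\<close> is the special pair offered by \<open>w\<^sub>1\<close> and
  \<open>w\<^sub>2\<close>. Only traces on \<open>Z\<close> are prescribed because moves may also
  reach into the clique.\<close>

locale path_covering = covering H for H :: "'a set set" +
  fixes Z :: "'a set" and s :: "'a \<Rightarrow> 'a" and z :: 'a
  assumes finite_Z: "finite Z"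
    and s_in: "x \<in> Z \<Longrightarrow> s x \<in> Z"
    and inj_s: "inj_on s Z"
    and z_in: "z \<in> Z"
    and moves: "h \<in> H \<Longrightarrow> h \<inter> Z = {} \<or> h \<inter> Z = {z, s (s z)} \<or> (\<exists>x\<in>Z. h \<inter> Z = {x, s x})"
    and edge: "x \<in> Z \<Longrightarrow> \<exists>h\<in>H. h \<inter> Z = {x, s x}"
begin

text \<open>The successor of a last vertex is outside, so \<open>x\<close> and \<open>s x\<close>
  lie in one run whenever both are present. The last clause puts \<open>z\<close>,
  \<open>s z\<close>, \<open>s (s z)\<close> in one run whenever both ends are present; then the
  special move never takes vertices of two different runs. Empty lists are allowed so that splitting
  a run needs no case distinction.\<close>

definition path_system :: "'a list list \<Rightarrow> bool" where
  "path_system Ls \<longleftrightarrow> pts Ls \<subseteq> Z \<and> distinct (concat Ls) \<and>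
     (\<forall>L\<in>set Ls. successively (\<lambda>x y. y = s x) L) \<and>
     (\<forall>L\<in>set Ls. L \<noteq> [] \<longrightarrow> s (last L) \<notin> pts Ls) \<and>
     (z \<in> pts Ls \<longrightarrow> s (s z) \<in> pts Ls \<longrightarrow> s z \<in> pts Ls)"

lemma path_system_Nil: "path_system []"
  by (simp add: path_system_def)

lemma path_systemD:
  assumes "path_system Ls"
  shows "pts Ls \<subseteq> Z" "distinct (concat Ls)"
    "L \<in> set Ls \<Longrightarrow> successively (\<lambda>x y. y = s x) L"
    "L \<in> set Ls \<Longrightarrow> L \<noteq> [] \<Longrightarrow> s (last L) \<notin> pts Ls"
    "z \<in> pts Ls \<Longrightarrow> s (s z) \<in> pts Ls \<Longrightarrow> s z \<in> pts Ls"
  using assms unfolding path_system_def by blast+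

lemma path_systemI:
  assumes "path_system Ls" "pts Ls' \<subseteq> pts Ls" "distinct (concat Ls')"
    and "\<And>L. L \<in> set Ls' \<Longrightarrow> L \<notin> set Ls \<Longrightarrow> successively (\<lambda>x y. y = s x) L"
    and "\<And>L. L \<in> set Ls' \<Longrightarrow> L \<notin> set Ls \<Longrightarrow> L \<noteq> [] \<Longrightarrow> s (last L) \<notin> pts Ls'"
    and "z \<in> pts Ls' \<Longrightarrow> s (s z) \<in> pts Ls' \<Longrightarrow> s z \<in> pts Ls \<Longrightarrow> s z \<in> pts Ls'"
  shows "path_system Ls'"
  unfolding path_system_def
proof (intro conjI ballI impI)
  show "pts Ls' \<subseteq> Z" using assms(2) path_systemD(1)[OF assms(1)] by blast
  fix L assume L: "L \<in> set Ls'"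
  show "successively (\<lambda>x y. y = s x) L"
    using assms(4)[OF L] path_systemD(3)[OF assms(1)] by blast
  assume "L \<noteq> []"
  then show "s (last L) \<notin> pts Ls'"
    using assms(5)[OF L] path_systemD(4)[OF assms(1)] assms(2) by blast
next
  assume zz: "z \<in> pts Ls'" "s (s z) \<in> pts Ls'"
  then have "s z \<in> pts Ls" using path_systemD(5)[OF assms(1)] assms(2) by blast
  then show "s z \<in> pts Ls'" using assms(6) zz by blast
qed (fact assms(3))

text \<open>If the removed \<open>x\<close> is the middle vertex \<open>s z\<close>, the clause on
  \<open>z\<close> survives because \<open>s (s z) = s x\<close> was outside already.\<close>

lemma path_system_remove_last:
  assumes ps: "path_system (As @ (P @ [x]) # Bs)"
  shows "path_system (As @ P # Bs)" "pts (As @ P # Bs) = pts (As @ (P @ [x]) # Bs) - {x}"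
proof -
  let ?Ls = "As @ (P @ [x]) # Bs"
  have dist: "distinct (concat ?Ls)" and succ: "successively (\<lambda>x y. y = s x) (P @ [x])"
    and sx: "s x \<notin> pts ?Ls"
    using path_systemD(2)[OF ps] path_systemD(3,4)[OF ps, of "P @ [x]"] by simp_all
  show pts: "pts (As @ P # Bs) = pts ?Ls - {x}"
    using dist unfolding distinct_concat_pts by auto
  show "path_system (As @ P # Bs)"
  proof (rule path_systemI[OF ps])
    show "distinct (concat (As @ P # Bs))" using dist unfolding distinct_concat_pts by auto
    show "pts (As @ P # Bs) \<subseteq> pts ?Ls" using pts by blast
    show "successively (\<lambda>x y. y = s x) L" "L \<noteq> [] \<Longrightarrow> s (last L) \<notin> pts (As @ P # Bs)"
      if "L \<in> set (As @ P # Bs)" "L \<notin> set ?Ls" for L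
    proof -
      have "L = P" using that by auto
      then show "successively (\<lambda>x y. y = s x) L" "L \<noteq> [] \<Longrightarrow> s (last L) \<notin> pts (As @ P # Bs)"
        using succ unfolding pts by (simp_all add: successively_append_iff)
    qed
  qed (use sx pts in blast)
qed

lemma path_system_remove_pair:
  assumes ps: "path_system (As @ (P @ x # y # Q) # Bs)"
  shows "path_system (As @ P # Q # Bs)"
    "pts (As @ P # Q # Bs) = pts (As @ (P @ x # y # Q) # Bs) - {x, y}"
proof -
  let ?Ls = "As @ (P @ x # y # Q) # Bs" and ?Ls' = "As @ P # Q # Bs"
  have dist: "distinct (concat ?Ls)" and succ: "successively (\<lambda>x y. y = s x) (P @ x # y # Q)"
    and lst: "s (last (x # y # Q)) \<notin> pts ?Ls"
    using path_systemD(2)[OF ps] path_systemD(3,4)[OF ps, of "P @ x # y # Q"] by simp_all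
  show pts: "pts ?Ls' = pts ?Ls - {x, y}"
    using dist unfolding distinct_concat_pts by auto
  have y: "y = s x" using succ by (simp add: successively_append_iff)
  have xZ: "x \<in> Z" using path_systemD(1)[OF ps] by auto
  show "path_system ?Ls'"
  proof (rule path_systemI[OF ps])
    show "distinct (concat ?Ls')" using dist unfolding distinct_concat_pts by auto
    show "pts ?Ls' \<subseteq> pts ?Ls" using pts by blast
    show "successively (\<lambda>x y. y = s x) L" "L \<noteq> [] \<Longrightarrow> s (last L) \<notin> pts ?Ls'"
      if "L \<in> set ?Ls'" "L \<notin> set ?Ls" for L
    proof -
      have "L = P \<or> L = Q" using that by auto
      then show "successively (\<lambda>x y. y = s x) L" "L \<noteq> [] \<Longrightarrow> s (last L) \<notin> pts ?Ls'"
        using succ lst unfolding pts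
        by (elim disjE; simp add: successively_append_iff successively_Cons)+
    qed
    \<comment> \<open>If \<open>s z = x\<close>, then \<open>s (s z) = y\<close> is removed too; if
      \<open>s z = y = s x\<close>, then \<open>z = x\<close> by injectivity. So one end of the
      triple is gone in either case.\<close>
    show "s z \<in> pts ?Ls'" if "z \<in> pts ?Ls'" "s (s z) \<in> pts ?Ls'" "s z \<in> pts ?Ls"
      using that inj_onD[OF inj_s _ z_in xZ] unfolding pts y by blast
  qed
qed

lemma path_system_remove_gap:
  assumes ps: "path_system (As @ (P @ z # y # v # Q) # Bs)"
  shows "path_system (As @ P # [y] # Q # Bs)"
    "pts (As @ P # [y] # Q # Bs) = pts (As @ (P @ z # y # v # Q) # Bs) - {z, v}"
proof -
  let ?Ls = "As @ (P @ z # y # v # Q) # Bs" and ?Ls' = "As @ P # [y] # Q # Bs"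
  have dist: "distinct (concat ?Ls)" and succ: "successively (\<lambda>x y. y = s x) (P @ z # y # v # Q)"
    and lst: "s (last (z # y # v # Q)) \<notin> pts ?Ls"
    using path_systemD(2)[OF ps] path_systemD(3,4)[OF ps, of "P @ z # y # v # Q"] by simp_all
  show pts: "pts ?Ls' = pts ?Ls - {z, v}"
    using dist unfolding distinct_concat_pts by auto
  have v: "v = s y" using succ by (simp add: successively_append_iff)
  show "path_system ?Ls'"
  proof (rule path_systemI[OF ps])
    show "distinct (concat ?Ls')" using dist unfolding distinct_concat_pts by auto
    show "pts ?Ls' \<subseteq> pts ?Ls" using pts by blast
    show "successively (\<lambda>x y. y = s x) L" "L \<noteq> [] \<Longrightarrow> s (last L) \<notin> pts ?Ls'"
      if "L \<in> set ?Ls'" "L \<notin> set ?Ls" for L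
    proof -
      have "L = P \<or> L = [y] \<or> L = Q" using that by auto
      then show "successively (\<lambda>x y. y = s x) L" "L \<noteq> [] \<Longrightarrow> s (last L) \<notin> pts ?Ls'"
        using succ lst v unfolding pts
        by (elim disjE; simp add: successively_append_iff successively_Cons)+
    qed
  qed (use pts in blast)
qed

section \<open>Effect of a single move on the bounds\<close>

definition runs_drop :: "'a list list \<Rightarrow> 'a list list \<Rightarrow> bool" where
  "runs_drop Ls Ls' \<longleftrightarrow>
     boundD Ls \<le> boundS Ls' + 1 \<and> (odd (runs_hot Ls) \<longrightarrow> boundD Ls \<le> boundD Ls' + 1)"

lemma runs_dropI:
  assumes "run_drop f (b + runs_hot Bs) f' (b' + runs_hot Bs)"
    and "runs_val Ls = f + runs_val Bs" "runs_hot Ls = b + runs_hot Bs"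
    and "runs_val Ls' = f' + runs_val Bs" "runs_hot Ls' = b' + runs_hot Bs"
  shows "runs_drop Ls Ls'"
  using assms unfolding runs_drop_def run_drop_def boundD_def boundS_def by auto

lemma remove_pair_drop:
  "runs_drop (As @ (P @ x # y # Q) # Bs) (As @ P # Q # Bs)"
  using run_drop_pair[of "length P" "length Q" "runs_hot (As @ Bs)"]
  by (rule runs_dropI) simp_all

lemma remove_singleton_drop:
  "runs_drop (As @ [x] # Bs) (As @ [] # Bs)"
proof (rule runs_dropI)
  show "run_drop (run_val 1) (run_hot 1 + runs_hot (As @ Bs)) 0 (0 + runs_hot (As @ Bs))"
    using run_drop_single by simp
qed (simp_all add: run_val_def run_hot_def)

lemma remove_gap_drop:
  "runs_drop (As @ (P @ x # y # v # Q) # Bs) (As @ P # [y] # Q # Bs)"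
proof -
  have "length (P @ x # y # v # Q) = length P + length Q + 3" by simp
  moreover have "run_val (length [y]) = 1" "run_hot (length [y]) = 0"
    by (simp_all add: run_val_def run_hot_def)
  ultimately show ?thesis
    using run_drop_gap[of "length P" "length Q" "runs_hot (As @ Bs)"]
    by (intro runs_dropI[where Bs = "As @ Bs"]) (assumption | simp only: runs_simps ac_simps)+
qed

lemma path_system_succ:
  assumes "path_system (As @ (P @ x # Q) # Bs)"
  shows "s x \<in> pts (As @ (P @ x # Q) # Bs) \<longleftrightarrow> Q \<noteq> []"
    and "Q = y # Q' \<Longrightarrow> y = s x"
proof -
  have succ: "successively (\<lambda>x y. y = s x) (P @ x # Q)"
    and lst: "s (last (x # Q)) \<notin> pts (As @ (P @ x # Q) # Bs)"
    using path_systemD(3,4)[OF assms, of "P @ x # Q"] by simp_all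
  show y: "y = s x" if "Q = y # Q'" for y Q'
    using succ that by (simp add: successively_append_iff)
  show "s x \<in> pts (As @ (P @ x # Q) # Bs) \<longleftrightarrow> Q \<noteq> []"
    using lst y by (cases Q) auto
qed

lemma pts_split:
  assumes "x \<in> pts Ls"
  obtains As Bs P Q where "Ls = As @ (P @ x # Q) # Bs"
  using assms unfolding pts_def by (metis UN_E split_list)

lemma remove_edge:
  assumes ps: "path_system Ls" and x: "x \<in> pts Ls"
  obtains Ls' where "path_system Ls'" "pts Ls' \<subseteq> pts Ls - {x, s x}" "runs_drop Ls Ls'"
proof -
  from x obtain As Bs P Q where Ls: "Ls = As @ (P @ x # Q) # Bs" by (rule pts_split)
  note ps' = ps[unfolded Ls]
  show thesis
  proof (cases Q)
    case (Cons y Q')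
    then have "y = s x" using path_system_succ(2)[OF ps'] by blast
    then show thesis
      using that[of "As @ P # Q' # Bs"] path_system_remove_pair[of As P x y Q' Bs]
        remove_pair_drop[of As P x y Q' Bs] ps' Cons Ls by blast
  next
    case Nil
    then have sx: "s x \<notin> pts Ls" using path_system_succ(1)[OF ps'] Ls by blast
    show thesis
    proof (cases P rule: rev_cases)
      case P: Nil
      show thesis
        using that[of "As @ [] # Bs"] path_system_remove_last[of As "[]" x Bs]
          remove_singleton_drop[of As x Bs] ps' Nil P Ls sx by auto
    next
      \<comment> \<open>The edge at the end of a run covers \<open>x\<close> only. Giving up its
        predecessor \<open>w\<close> as well just shrinks the position and reduces this case to the
        removal of a pair.\<close>
      case (snoc P' w)
      then have eq: "P @ x # Q = P' @ w # x # []" using Nil by simp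
      have "pts (As @ P' # [] # Bs) \<subseteq> pts Ls - {x, s x}"
        using path_system_remove_pair(2)[OF ps'[unfolded eq]] sx unfolding Ls eq by blast
      then show thesis
        using that[of "As @ P' # [] # Bs"] path_system_remove_pair(1)[OF ps'[unfolded eq]]
          remove_pair_drop[of As P' w x "[]" Bs] Ls eq by metis
    qed
  qed
qed

text \<open>This holds for every move, hence for the best one of Dominator. By
  \<open>val_mono\<close> it suffices that the remaining position contains the new system, so
  vertices outside \<open>h\<close> may be given up as well.\<close>

lemma path_system_reply:
  assumes ps: "path_system Ls" and h: "h \<in> H"
  obtains Ls' where "path_system Ls'" "pts Ls' \<subseteq> pts Ls - h" "runs_drop Ls Ls'"
proof -
  have LZ: "pts Ls \<subseteq> Z" using ps by (rule path_systemD(1))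
  then have hZ: "pts Ls - h = pts Ls - h \<inter> Z" by blast
  \<comment> \<open>The case \<open>edge\<close> includes every move that hits a single vertex of
    the runs, in particular the special move when only one of its two vertices is left.\<close>
  consider (none) "pts Ls \<inter> h = {}"
    | (gap) "h \<inter> Z = {z, s (s z)}" "z \<in> pts Ls" "s (s z) \<in> pts Ls"
    | (edge) x where "x \<in> pts Ls" "pts Ls \<inter> (h \<inter> Z) \<subseteq> {x, s x}"
  proof (cases "pts Ls \<inter> h = {}")
    case False
    then obtain x where x: "x \<in> pts Ls" "x \<in> h \<inter> Z" using LZ by blast
    show thesis
    proof (cases "pts Ls \<inter> (h \<inter> Z) \<subseteq> {x}")
      case True
      then show thesis using edge[of x] x by blast
    next
      case False
      then obtain y where y: "y \<in> pts Ls" "y \<in> h \<inter> Z" "y \<noteq> x" by blast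
      from moves[OF h] x y consider "h \<inter> Z = {z, s (s z)}" | w where "h \<inter> Z = {w, s w}" by blast
      then show thesis
      proof cases
        case 1
        then have "x = z \<and> y = s (s z) \<or> y = z \<and> x = s (s z)" using x(2) y(2,3) by auto
        then show thesis using gap 1 x y by blast
      next
        case (2 w)
        then have "w = x \<or> w = y" using x(2) y(2,3) by auto
        then show thesis using edge[of w] x y 2 by blast
      qed
    qed
  qed
  then show thesis
  proof cases
    case none
    have "runs_drop Ls Ls"
      unfolding runs_drop_def boundD_def boundS_def by simp
    then show thesis
      using that[of Ls] ps none by blast
  next
    case gap
    then have sz: "s z \<in> pts Ls" using path_systemD(5)[OF ps] by blast
    from gap(2) obtain As Bs P Q where Ls: "Ls = As @ (P @ z # Q) # Bs" by (rule pts_split)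
    then obtain y Q1 where Q: "Q = y # Q1"
      using sz path_system_succ(1) ps by (metis list.exhaust)
    then have y: "y = s z" using path_system_succ(2) ps Ls by blast
    have Ls1: "Ls = As @ ((P @ [z]) @ y # Q1) # Bs" using Ls Q by simp
    then obtain v Q2 where Q1: "Q1 = v # Q2"
      using gap(3) path_system_succ(1) ps y by (metis list.exhaust)
    then have v: "v = s (s z)" using path_system_succ(2) ps Ls1 y by blast
    have Ls2: "Ls = As @ (P @ z # y # v # Q2) # Bs" using Ls Q Q1 by simp
    show thesis
    proof (rule that)
      show "path_system (As @ P # [y] # Q2 # Bs)"
        using path_system_remove_gap(1) ps unfolding Ls2 by blast
      show "pts (As @ P # [y] # Q2 # Bs) \<subseteq> pts Ls - h"
        using path_system_remove_gap(2)[OF ps[unfolded Ls2]] hZ gap(1) v unfolding Ls2 by blast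
      show "runs_drop Ls (As @ P # [y] # Q2 # Bs)"
        unfolding Ls2 by (rule remove_gap_drop)
    qed
  next
    case (edge x)
    from remove_edge[OF ps edge(1)] obtain Ls'
      where "path_system Ls'" "pts Ls' \<subseteq> pts Ls - {x, s x}" "runs_drop Ls Ls'" .
    then show thesis using that[of Ls'] edge(2) hZ by blast
  qed
qed

text \<open>Staller covers just the last vertex of a run, preferably of length 2 modulo 3: that run
  keeps its value and merely stops being hot. Without hot runs, shortening a nonempty one costs
  value 1, which the move itself makes up for.\<close>

lemma path_system_staller:
  assumes ps: "path_system Ls" and ne: "pts Ls \<noteq> {}"
  obtains h x Ls' where "h \<in> H" "x \<in> pts Ls" "h \<inter> Z = {x, s x}"
    "path_system Ls'" "pts Ls' = pts Ls - h" "boundS Ls \<le> boundD Ls' + 1"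
proof -
  obtain L where L: "L \<in> set Ls" "L \<noteq> []"
    and hot: "runs_hot Ls > 0 \<Longrightarrow> length L mod 3 = 2"
  proof (cases "\<exists>L\<in>set Ls. length L mod 3 = 2")
    case True
    then obtain L where "L \<in> set Ls" "length L mod 3 = 2" by blast
    then show ?thesis using that[of L] by fastforce
  next
    case False
    then have "runs_hot Ls = 0" by (auto simp: runs_hot_def run_hot_def sum_list_eq_0_iff)
    moreover obtain L where "L \<in> set Ls" "L \<noteq> []" using ne unfolding pts_def by fastforce
    ultimately show ?thesis using that[of L] by auto
  qed
  obtain P x where Px: "L = P @ [x]" using L(2) rev_exhaust by blast
  obtain As Bs where Ls: "Ls = As @ (P @ [x]) # Bs" using L(1) Px by (metis split_list)
  have xZ: "x \<in> Z" and xs: "x \<in> pts Ls" and sx: "s x \<notin> pts Ls" and LZ: "pts Ls \<subseteq> Z"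
    using path_systemD(1)[OF ps] path_systemD(4)[OF ps L] Px unfolding Ls by auto
  obtain h where h: "h \<in> H" "h \<inter> Z = {x, s x}" using edge[OF xZ] by blast
  have "boundS Ls \<le> boundD (As @ P # Bs) + 1"
  proof (cases rule: mod3_cases[of "length P"])
    case (1 q)
    then have "length L = 3 * q + 1" using Px by simp
    then have "runs_hot Ls = 0" using hot by (cases "runs_hot Ls > 0") auto
    then show ?thesis unfolding Ls boundS_def boundD_def using 1 run_val_3(2)[of q] by simp
  next
    case (2 q)
    then have lL: "length P = 3 * q + 1" "length P + 1 = 3 * q + 2" using Px by simp_all
    show ?thesis unfolding Ls boundS_def boundD_def
      using run_val_3[of q] run_hot_3[of q] lL by (simp add: Px)
  next
    case (3 q)
    then have lL: "length P = 3 * q + 2" "length P + 1 = 3 * (q + 1)" using Px by simp_all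
    have "length L = 3 * (q + 1)" using Px lL by simp
    then have "runs_hot Ls = 0" using hot by (cases "runs_hot Ls > 0") auto
    then show ?thesis unfolding Ls boundS_def boundD_def
      using run_val_3(3)[of q] run_hot_3(3)[of q] lL
      by (simp add: run_val_def[of "Suc (Suc (Suc (3 * q)))"])
  qed
  moreover have "pts (As @ P # Bs) = pts Ls - h"
    using path_system_remove_last(2)[of As P x Bs] ps h(2) sx LZ unfolding Ls by blast
  ultimately show thesis
    using that[OF h(1) xs h(2) path_system_remove_last(1)[OF ps[unfolded Ls]]] by blast
qed

text \<open>Simultaneous induction for both players: Staller uses the move of
  \<open>path_system_staller\<close>, and every move of Dominator is controlled by
  \<open>path_system_reply\<close> together with \<open>val_mono\<close>.\<close>

lemma val_ge_bound:
  "path_system Ls \<Longrightarrow> boundD Ls \<le> valD (pts Ls) \<and> boundS Ls \<le> valS (pts Ls)"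
proof (induction "card (pts Ls)" arbitrary: Ls rule: less_induct)
  case less
  show ?case
  proof (cases "pts Ls = {}")
    case True
    then show ?thesis using runs_zero[OF True] by (simp add: boundD_def boundS_def)
  next
    case ne: False
    have IH: "boundD Ls' \<le> valD (pts Ls') \<and> boundS Ls' \<le> valS (pts Ls')"
      if "path_system Ls'" "pts Ls' \<subseteq> pts Ls - h" "h \<inter> pts Ls \<noteq> {}" for Ls' h
      using that less.hyps[OF psubset_card_mono[OF finite_pts]] by blast
    have "boundS Ls \<le> valS (pts Ls)"
    proof -
      from path_system_staller[OF less.prems ne] obtain h x Ls' where
        h: "h \<in> H" "x \<in> pts Ls" "h \<inter> Z = {x, s x}"
        "path_system Ls'" "pts Ls' = pts Ls - h" "boundS Ls \<le> boundD Ls' + 1" .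
      then have hit: "h \<inter> pts Ls \<noteq> {}" by blast
      have "boundS Ls \<le> 1 + valD (pts Ls - h)" using IH[OF h(4) _ hit] h(5,6) by fastforce
      also have "\<dots> \<le> valS (pts Ls)" using valS_ge[OF finite_pts h(1) hit] .
      finally show ?thesis .
    qed
    moreover have "boundD Ls \<le> valD (pts Ls)"
    proof -
      obtain x where x: "x \<in> pts Ls" using ne by blast
      then obtain h0 where h0: "h0 \<in> H" "h0 \<inter> pts Ls \<noteq> {}"
        using edge path_systemD(1)[OF less.prems] by blast
      show ?thesis
      proof (rule valD_ge[OF finite_pts h0])
        fix h assume h: "h \<in> H" "h \<inter> pts Ls \<noteq> {}"
        from path_system_reply[OF less.prems h(1)] obtain Ls' where
          Ls': "path_system Ls'" "pts Ls' \<subseteq> pts Ls - h" "runs_drop Ls Ls'" .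
        have "boundD Ls \<le> 1 + boundS Ls'" using Ls'(3) by (simp add: runs_drop_def)
        also have "\<dots> \<le> 1 + valS (pts Ls')" using IH[OF Ls'(1,2) h(2)] by simp
        also have "\<dots> \<le> 1 + valS (pts Ls - h)" using val_mono[OF _ Ls'(2)] by simp
        finally show "boundD Ls \<le> 1 + valS (pts Ls - h)" .
      qed
    qed
    ultimately show ?thesis by blast
  qed
qed

section \<open>Untouched cycles\<close>

definition chain :: "'a \<Rightarrow> nat \<Rightarrow> nat \<Rightarrow> 'a list" where
  "chain x i k = map (\<lambda>j. (s ^^ j) x) [i..<k]"

text \<open>A cycle of \<open>s\<close> of exact length \<open>k\<close>. The description is
  required from every starting point, since a cycle is cut open wherever the first move
  falls.\<close>

definition orbit :: "nat \<Rightarrow> 'a set \<Rightarrow> bool" where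
  "orbit k C \<longleftrightarrow> C \<noteq> {} \<and> C \<subseteq> Z \<and>
     (\<forall>x\<in>C. C = set (chain x 0 k) \<and> distinct (chain x 0 k) \<and> (s ^^ k) x = x)"

lemma set_chain: "set (chain x i k) = {(s ^^ j) x | j. i \<le> j \<and> j < k}"
  by (auto simp: chain_def)

lemma successively_chain: "successively (\<lambda>x y. y = s x) (chain x i k)"
  by (simp add: chain_def successively_conv_nth)

lemma last_chain: "i < k \<Longrightarrow> s (last (chain x i k)) = (s ^^ k) x"
  by (cases k) (auto simp: chain_def)

lemma length_chain [simp]: "length (chain x i k) = k - i"
  by (simp add: chain_def)

lemma chain_Cons: "i < k \<Longrightarrow> chain x i k = (s ^^ i) x # chain x (Suc i) k"
  by (simp add: chain_def upt_conv_Cons)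

lemma orbitD:
  assumes "orbit k C"
  shows "C \<noteq> {}" "C \<subseteq> Z" "x \<in> C \<Longrightarrow> C = set (chain x 0 k)" "x \<in> C \<Longrightarrow> distinct (chain x 0 k)"
    "x \<in> C \<Longrightarrow> (s ^^ k) x = x" "k > 0"
proof -
  show "k > 0" using assms by (cases k) (auto simp: orbit_def chain_def)
qed (use assms in \<open>auto simp: orbit_def\<close>)

lemma orbit_funpow: "orbit k C \<Longrightarrow> x \<in> C \<Longrightarrow> (s ^^ j) x \<in> C"
proof (induction j)
  case (Suc j)
  let ?y = "(s ^^ j) x"
  have y: "?y \<in> C" using Suc by simp
  then have "(s ^^ 1) ?y \<in> C"
  proof (cases "k = 1")
    case True
    then show ?thesis using orbitD(5)[OF Suc.prems(1) y] y by simp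
  next
    case False
    then have "1 < k" using orbitD(6)[OF Suc.prems(1)] by simp
    then have "(s ^^ 1) ?y \<in> set (chain ?y 0 k)" unfolding chain_def by (auto intro!: image_eqI)
    then show ?thesis using orbitD(3)[OF Suc.prems(1) y] by simp
  qed
  then show ?case by simp
qed simp

text \<open>Backwards: the vertex of the cycle that precedes \<open>s x\<close> is also sent to
  \<open>s x\<close>, so it is \<open>x\<close> by injectivity.\<close>

lemma orbit_succ_iff:
  assumes "orbit k C" "x \<in> Z"
  shows "s x \<in> C \<longleftrightarrow> x \<in> C"
proof
  show "s x \<in> C" if "x \<in> C" using orbit_funpow[OF assms(1) that, of 1] by simp
  assume sx: "s x \<in> C"
  obtain i where k: "k = Suc i" using orbitD(6)[OF assms(1)] gr0_conv_Suc by blast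
  have y: "(s ^^ i) (s x) \<in> C" using orbit_funpow[OF assms(1) sx] .
  have "s ((s ^^ i) (s x)) = s x" using orbitD(5)[OF assms(1) sx] k by simp
  then have "(s ^^ i) (s x) = x" using inj_onD[OF inj_s] y orbitD(2)[OF assms(1)] assms(2) by blast
  then show "x \<in> C" using y by simp
qed

text \<open>Both kinds of moves join vertices linked by steps of \<open>s\<close>, which never cross
  between \<open>C\<close> and the rest of \<open>Z\<close>.\<close>

lemma orbit_edge:
  assumes C: "orbit k C" and h: "h \<in> H" "h \<inter> C \<noteq> {}"
  shows "h \<inter> Z \<subseteq> C"
proof -
  obtain y where y: "y \<in> h \<inter> Z" "y \<in> C" using h orbitD(2)[OF C] by blast
  from moves[OF h(1)] y consider "h \<inter> Z = {z, s (s z)}" | x where "x \<in> Z" "h \<inter> Z = {x, s x}"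
    by blast
  then show ?thesis
  proof cases
    case 1
    have "s (s z) \<in> C \<longleftrightarrow> z \<in> C" using orbit_succ_iff[OF C] z_in s_in by simp
    then show ?thesis using 1 y by auto
  next
    case (2 x)
    then show ?thesis using y orbit_succ_iff[OF C 2(1)] by auto
  qed
qed

text \<open>The first edge cuts the cycle into one run starting at \<open>s (s x)\<close>; the
  vertex after its end is \<open>x\<close>, now covered.\<close>

lemma orbit_open:
  assumes C: "orbit k C" and k: "k \<ge> 3" and ps: "path_system Ls" and disj: "C \<inter> pts Ls = {}"
    and x: "x \<in> C"
  shows "path_system (chain x 2 k # Ls)" "set (chain x 2 k) = C - {x, s x}"
proof -
  have ch: "chain x 0 k = x # s x # chain x 2 k"
    using k by (simp add: chain_Cons numeral_2_eq_2)
  show set: "set (chain x 2 k) = C - {x, s x}"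
    using orbitD(3,4)[OF C x] unfolding ch by auto
  have zC: "s z \<in> C \<longleftrightarrow> z \<in> C" "s (s z) \<in> C \<longleftrightarrow> z \<in> C"
    using orbit_succ_iff[OF C] z_in s_in by simp_all
  have xZ: "x \<in> Z" using x orbitD(2)[OF C] by blast
  let ?Ls = "chain x 2 k # Ls"
  have pts: "pts ?Ls = (C - {x, s x}) \<union> pts Ls" using set by simp
  show "path_system ?Ls"
    unfolding path_system_def
  proof (intro conjI ballI impI)
    show "pts ?Ls \<subseteq> Z" using pts orbitD(2)[OF C] path_systemD(1)[OF ps] by blast
    show "distinct (concat ?Ls)"
      using path_systemD(2)[OF ps] orbitD(4)[OF C x] disj set
      unfolding distinct_concat_pts ch by auto
    fix L assume L: "L \<in> set ?Ls"
    show "successively (\<lambda>x y. y = s x) L"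
      using L path_systemD(3)[OF ps] successively_chain by auto
    assume ne: "L \<noteq> []"
    show "s (last L) \<notin> pts ?Ls"
    proof (cases "L \<in> set Ls")
      case True
      have last: "last L \<in> pts Ls" using True last_in_set[OF ne] unfolding pts_def by blast
      then have "s (last L) \<notin> C"
        using orbit_succ_iff[OF C] path_systemD(1)[OF ps] disj by blast
      then show ?thesis using path_systemD(4)[OF ps True ne] unfolding pts by blast
    next
      case False
      then have "s (last L) = x" using L last_chain[of 2 k x] k orbitD(5)[OF C x] by simp
      then show ?thesis unfolding pts using x disj by blast
    qed
  next
    assume zz: "z \<in> pts ?Ls" "s (s z) \<in> pts ?Ls"
    show "s z \<in> pts ?Ls"
    proof (cases "z \<in> C")
      case True
      then have "z \<noteq> x" "s z \<noteq> x" using zz zC disj unfolding pts by auto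
      moreover have "s z \<noteq> s x" using inj_onD[OF inj_s _ z_in xZ] \<open>z \<noteq> x\<close> by blast
      ultimately show ?thesis using zC True unfolding pts by blast
    next
      case False
      then show ?thesis using zz zC path_systemD(5)[OF ps] unfolding pts by blast
    qed
  qed
qed

lemma orbit_open_gap:
  assumes C: "orbit k C" and k: "k \<ge> 4" and ps: "path_system Ls" and disj: "C \<inter> pts Ls = {}"
    and z: "z \<in> C"
  shows "path_system ([s z] # chain z 3 k # Ls)"
    "pts ([s z] # chain z 3 k # Ls) = (C - {z, s (s z)}) \<union> pts Ls"
proof -
  have ch: "chain z 0 k = z # s z # s (s z) # chain z 3 k"
    using k by (simp add: chain_Cons numeral_2_eq_2 numeral_3_eq_3)
  have set: "insert (s z) (set (chain z 3 k)) = C - {z, s (s z)}"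
    using orbitD(3,4)[OF C z] unfolding ch by auto
  let ?Ls = "[s z] # chain z 3 k # Ls"
  show pts: "pts ?Ls = (C - {z, s (s z)}) \<union> pts Ls" using set by auto
  show "path_system ?Ls"
    unfolding path_system_def
  proof (intro conjI ballI impI)
    show "pts ?Ls \<subseteq> Z" using pts orbitD(2)[OF C] path_systemD(1)[OF ps] by blast
    have "set [s z] \<inter> pts Ls = {}" "set (chain z 3 k) \<inter> pts Ls = {}" using set disj by auto
    then show "distinct (concat ?Ls)"
      using path_systemD(2)[OF ps] orbitD(4)[OF C z]
      unfolding distinct_concat_pts ch by auto
    fix L assume L: "L \<in> set ?Ls"
    show "successively (\<lambda>x y. y = s x) L"
      using L path_systemD(3)[OF ps] successively_chain by auto
    assume ne: "L \<noteq> []"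
    show "s (last L) \<notin> pts ?Ls"
    proof (cases "L \<in> set Ls")
      case True
      have last: "last L \<in> pts Ls" using True last_in_set[OF ne] unfolding pts_def by blast
      then have "s (last L) \<notin> C"
        using orbit_succ_iff[OF C] path_systemD(1)[OF ps] disj by blast
      then show ?thesis using path_systemD(4)[OF ps True ne] unfolding pts by blast
    next
      case False
      then have "s (last L) \<in> {z, s (s z)}"
        using L last_chain[of 3 k z] k orbitD(5)[OF C z] by auto
      moreover have "s (s z) \<in> C" using orbit_funpow[OF C z, of 2] by (simp add: numeral_2_eq_2)
      ultimately have "s (last L) \<in> C \<inter> {z, s (s z)}" using z by auto
      then show ?thesis unfolding pts using disj by blast
    qed
  next
    assume "z \<in> pts ?Ls"
    then show "s z \<in> pts ?Ls" by simp
  qed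
qed

text \<open>The opened cycle is a run of length \<open>3 * (t - 1) + 2\<close>, which has value
  \<open>2 * t - 1\<close> and is hot. The extra hot run switches the direction of rounding, so
  \<open>boundD\<close> and \<open>boundS\<close> trade places.\<close>

lemma boundD_open: "t > 0 \<Longrightarrow> boundD (chain x 2 (3 * t + 1) # Ls) + 1 = boundS Ls + 2 * t"
  and boundS_open: "t > 0 \<Longrightarrow> boundS (chain x 2 (3 * t + 1) # Ls) = boundD Ls + 2 * t"
proof -
  assume "t > 0"
  then obtain q where t: "t = Suc q" using gr0_conv_Suc by blast
  have l: "length (chain x 2 (3 * t + 1)) = 3 * q + 2" using t by simp
  show "boundD (chain x 2 (3 * t + 1) # Ls) + 1 = boundS Ls + 2 * t"
    "boundS (chain x 2 (3 * t + 1) # Ls) = boundD Ls + 2 * t"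
    unfolding boundD_def boundS_def runs_simps l run_val_3 run_hot_3 using t by simp_all
qed

text \<open>The pieces have lengths 1 and \<open>3 * (t - 1) + 1\<close> and values \<open>1\<close>
  and \<open>2 * t - 1\<close>; neither is hot, so the roundings stay as they are.\<close>

lemma bound_open_gap:
  assumes "t > 0"
  shows "boundD ([y] # chain x 3 (3 * t + 1) # Ls) = boundD Ls + 2 * t"
    "boundS ([y] # chain x 3 (3 * t + 1) # Ls) = boundS Ls + 2 * t"
proof -
  obtain q where t: "t = Suc q" using assms gr0_conv_Suc by blast
  have l: "length (chain x 3 (3 * t + 1)) = 3 * q + 1" using t by simp
  have y: "run_val (length [y]) = 1" "run_hot (length [y]) = 0"
    by (simp_all add: run_val_def run_hot_def)
  show "boundD ([y] # chain x 3 (3 * t + 1) # Ls) = boundD Ls + 2 * t"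
    "boundS ([y] # chain x 3 (3 * t + 1) # Ls) = boundS Ls + 2 * t"
    unfolding boundD_def boundS_def runs_simps l y run_val_3 run_hot_3 using t by simp_all
qed

lemma orbit_reply:
  assumes C: "orbit (3 * t + 1) C" and t: "t > 0"
    and ps: "path_system Ls" and disj: "C \<inter> pts Ls = {}"
    and h: "h \<in> H" "h \<inter> C \<noteq> {}"
  obtains Ls' where "path_system Ls'" "pts Ls' = (C \<union> pts Ls) - h" "boundD Ls + 2 * t \<le> boundS Ls'"
proof -
  have hC: "h \<inter> Z \<subseteq> C" using orbit_edge[OF C h] .
  have hh: "(C \<union> pts Ls) - h = (C - h \<inter> Z) \<union> pts Ls"
    using hC disj orbitD(2)[OF C] path_systemD(1)[OF ps] by blast
  have "h \<inter> Z \<noteq> {}" using h(2) orbitD(2)[OF C] by blast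
  with moves[OF h(1)] consider "h \<inter> Z = {z, s (s z)}" | x where "x \<in> Z" "h \<inter> Z = {x, s x}"
    by blast
  then show thesis
  proof cases
    case 1
    then have z: "z \<in> C" using hC by blast
    have "boundD Ls \<le> boundS Ls" by (simp add: boundD_def boundS_def div_le_mono)
    then show thesis
      using that[of "[s z] # chain z 3 (3 * t + 1) # Ls"] orbit_open_gap[OF C _ ps disj z]
        bound_open_gap(2)[OF t, of "s z" z Ls] t hh 1 by simp
  next
    case (2 x)
    then have x: "x \<in> C" using hC by blast
    show thesis
      using that[of "chain x 2 (3 * t + 1) # Ls"] orbit_open[OF C _ ps disj x]
        boundS_open[OF t, of x Ls] t hh 2(2) by simp
  qed
qed

text \<open>
  A full cycle of length 1 modulo 3 is a zugzwang: opening it costs a move to the player who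
  does so, hence the roundings by parity.
\<close>

lemma val_ge_bound_orbit:
  assumes C: "orbit (3 * t + 1) C" and t: "t > 0"
  shows "path_system Ls \<Longrightarrow> C \<inter> pts Ls = {} \<Longrightarrow>
    2 * t + 2 * (boundD Ls div 2) + 1 \<le> valD (C \<union> pts Ls) \<and>
    2 * t + 2 * ((boundS Ls + 1) div 2) \<le> valS (C \<union> pts Ls)"
proof (induction "card (pts Ls)" arbitrary: Ls rule: less_induct)
  case less
  note ps = less.prems(1) and disj = less.prems(2)
  let ?A = "C \<union> pts Ls"
  have CZ: "C \<subseteq> Z" and LZ: "pts Ls \<subseteq> Z" using orbitD(2)[OF C] path_systemD(1)[OF ps] by auto
  then have finA: "finite ?A" using finite_Z finite_subset by auto
  have IH: "2 * t + 2 * (boundD Ls' div 2) + 1 \<le> valD (C \<union> pts Ls')"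
    "2 * t + 2 * ((boundS Ls' + 1) div 2) \<le> valS (C \<union> pts Ls')"
    if "path_system Ls'" "pts Ls' \<subseteq> pts Ls - h" "h \<inter> pts Ls \<noteq> {}" for Ls' h
    using that less.hyps[OF psubset_card_mono[OF finite_pts], of Ls'] disj by blast+
  obtain x0 where x0: "x0 \<in> C" using orbitD(1)[OF C] by blast
  then obtain h0 where h0: "h0 \<in> H" "h0 \<inter> Z = {x0, s x0}" using edge CZ by blast
  have hit0: "h0 \<inter> ?A \<noteq> {}" "h0 \<inter> C \<noteq> {}" using h0(2) x0 by blast+
  have "2 * t + 2 * (boundD Ls div 2) + 1 \<le> valD ?A"
  proof (rule valD_ge[OF finA h0(1) hit0(1)])
    fix h assume h: "h \<in> H" "h \<inter> ?A \<noteq> {}"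
    show "2 * t + 2 * (boundD Ls div 2) + 1 \<le> 1 + valS (?A - h)"
    proof (cases "h \<inter> C = {}")
      case True
      then have hit: "h \<inter> pts Ls \<noteq> {}" using h by blast
      from path_system_reply[OF ps h(1)] obtain Ls' where
        Ls': "path_system Ls'" "pts Ls' \<subseteq> pts Ls - h" "runs_drop Ls Ls'" .
      have "boundD Ls \<le> 1 + boundS Ls'" using Ls'(3) by (simp add: runs_drop_def)
      then have "2 * t + 2 * (boundD Ls div 2) + 1 \<le> 1 + (2 * t + 2 * ((boundS Ls' + 1) div 2))"
        by simp
      also have "\<dots> \<le> 1 + valS (C \<union> pts Ls')" using IH(2)[OF Ls'(1,2) hit] by simp
      also have "\<dots> \<le> 1 + valS (?A - h)"
      proof -
        have "C \<union> pts Ls' \<subseteq> ?A - h" using True Ls'(2) by blast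
        then show ?thesis using val_mono[of "?A - h"] finA by simp
      qed
      finally show ?thesis .
    next
      case False
      from orbit_reply[OF C t ps disj h(1) False] obtain Ls' where
        Ls': "path_system Ls'" "pts Ls' = ?A - h" "boundD Ls + 2 * t \<le> boundS Ls'" .
      have "boundS Ls' \<le> valS (?A - h)" using val_ge_bound[OF Ls'(1)] Ls'(2) by simp
      then show ?thesis using Ls'(3) by simp
    qed
  qed
  moreover have "2 * t + 2 * ((boundS Ls + 1) div 2) \<le> valS ?A"
  \<comment> \<open>If \<open>boundS Ls\<close> is even, rounding changes nothing and Staller opens
    the cycle herself. If it is odd, the claim demands one move more; she plays in the runs and
    leaves the zugzwang to Dominator.\<close>
  proof (cases "even (boundS Ls)")
    case True
    have eq: "?A - h0 = pts (chain x0 2 (3 * t + 1) # Ls)"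
    proof -
      have "s x0 \<in> C" using orbit_succ_iff[OF C] x0 CZ by blast
      then have "{x0, s x0} \<inter> pts Ls = {}" using x0 disj by blast
      moreover have "?A - h0 = ?A - h0 \<inter> Z" using CZ LZ by blast
      ultimately have "?A - h0 = (C - {x0, s x0}) \<union> pts Ls" unfolding h0(2) by blast
      then show ?thesis using orbit_open(2)[OF C _ ps disj x0] t by simp
    qed
    have "boundD (chain x0 2 (3 * t + 1) # Ls) \<le> valD (?A - h0)"
      unfolding eq using t by (intro val_ge_bound[THEN conjunct1] orbit_open(1)[OF C _ ps disj x0]) simp
    then have "2 * t + boundS Ls \<le> valS ?A"
      using valS_ge[OF finA h0(1) hit0(1)] boundD_open[OF t, of x0 Ls] by linarith
    then show ?thesis using True by simp
  next
    case odd: False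
    then have ne: "pts Ls \<noteq> {}" using runs_zero by (fastforce simp: boundS_def)
    from path_system_staller[OF ps ne] obtain h x Ls' where
      h: "h \<in> H" "x \<in> pts Ls" "h \<inter> Z = {x, s x}"
      "path_system Ls'" "pts Ls' = pts Ls - h" "boundS Ls \<le> boundD Ls' + 1" .
    have hit: "h \<inter> pts Ls \<noteq> {}" "h \<inter> ?A \<noteq> {}" using h by blast+
    have "x \<notin> C" "x \<in> Z" using h(2) LZ disj by blast+
    then have "{x, s x} \<inter> C = {}" using orbit_succ_iff[OF C] by blast
    then have "h \<inter> C = {}" using h(3) CZ by blast
    then have "?A - h = C \<union> pts Ls'" using h(5) by blast
    then have "2 * t + 2 * (boundD Ls' div 2) + 1 \<le> valD (?A - h)"
      using IH(1)[OF h(4) _ hit(1)] h(5) by simp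
    then have "2 * t + 2 * (boundD Ls' div 2) + 2 \<le> valS ?A"
      using valS_ge[OF finA h(1) hit(2)] by linarith
    moreover obtain m where m: "boundS Ls = 2 * m + 1" using odd oddE by blast
    moreover have "m \<le> boundD Ls' div 2" using h(6) m by simp
    ultimately show ?thesis by simp
  qed
  ultimately show ?case by blast
qed

end

text \<open>Abstracts the cycle of even length \<open>6 t + 2\<close>: stepping by two splits it
  into the odd and the even vertices, \<open>3 t + 1\<close> each, and the special pair lies in
  \<open>C\<close>.\<close>

locale two_orbits = path_covering +
  fixes C C' :: "'a set" and t :: nat
  assumes orbit_C: "orbit (3 * t + 1) C" and orbit_C': "orbit (3 * t + 1) C'"
    and t_pos: "t > 0" and Z_eq: "Z = C \<union> C'" and C_disj: "C \<inter> C' = {}" and z_C: "z \<in> C"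
begin

section \<open>Bounds on the two cycles\<close>

lemma split_orbits:
  assumes "x \<in> Z"
  obtains K K' where "x \<in> K" "orbit (3 * t + 1) K" "orbit (3 * t + 1) K'" "Z = K \<union> K'" "K \<inter> K' = {}"
proof (cases "x \<in> C")
  case True
  then show thesis using that[of C C'] orbit_C orbit_C' Z_eq C_disj by blast
next
  case False
  then show thesis using that[of C' C] orbit_C orbit_C' Z_eq C_disj assms by blast
qed

text \<open>The first move opens one cycle into runs with \<open>boundS\<close> at least
  \<open>2 * t\<close>, and Staller then faces these runs beside the other cycle, still
  untouched.\<close>

lemma valD_Z: "4 * t + 1 \<le> valD Z"
proof -
  obtain h0 where h0: "h0 \<in> H" "h0 \<inter> Z \<noteq> {}" using edge[OF z_in] by blast
  show ?thesis
  proof (rule valD_ge[OF finite_Z h0])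
    fix h assume h: "h \<in> H" "h \<inter> Z \<noteq> {}"
    then obtain x where x: "x \<in> h" "x \<in> Z" by blast
    from split_orbits[OF x(2)] obtain K K' where K: "x \<in> K" "orbit (3 * t + 1) K"
      "orbit (3 * t + 1) K'" "Z = K \<union> K'" "K \<inter> K' = {}" .
    have hit: "h \<inter> K \<noteq> {}" using x K by blast
    from orbit_reply[OF K(2) t_pos path_system_Nil _ h(1) hit] obtain Ls' where
      Ls': "path_system Ls'" "pts Ls' = K - h" "2 * t \<le> boundS Ls'" by auto
    have "4 * t \<le> 2 * t + 2 * ((boundS Ls' + 1) div 2)" using Ls'(3) by simp
    also have "\<dots> \<le> valS (K' \<union> pts Ls')"
      using val_ge_bound_orbit[OF K(3) t_pos Ls'(1)] Ls'(2) K(5) by blast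
    also have "K' \<union> pts Ls' = Z - h"
      using orbit_edge[OF K(2) h(1) hit] Ls'(2) K(4,5) by blast
    finally show "4 * t + 1 \<le> 1 + valS (Z - h)" by simp
  qed
qed

text \<open>The opened cycle has \<open>boundD\<close> equal to the even number
  \<open>2 * t\<close>, so rounding loses nothing and Dominator pays the extra move for the
  untouched cycle \<open>C'\<close>.\<close>

lemma valD_Z_gap: "4 * t + 1 \<le> valD (Z - {z, s (s z)})"
proof -
  let ?Ls = "[s z] # chain z 3 (3 * t + 1) # []"
  have ps: "path_system ?Ls" and pts: "pts ?Ls = C - {z, s (s z)}"
    using orbit_open_gap[OF orbit_C _ path_system_Nil _ z_C] t_pos by simp_all
  have "s (s z) \<in> C" using orbit_funpow[OF orbit_C z_C, of 2] by (simp add: numeral_2_eq_2)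
  then have eq: "Z - {z, s (s z)} = C' \<union> pts ?Ls" using pts Z_eq C_disj z_C by blast
  have "boundD ?Ls = 2 * t" using bound_open_gap(1)[OF t_pos, of "s z" z "[]"] by simp
  moreover have "C' \<inter> pts ?Ls = {}" using pts C_disj by blast
  ultimately show ?thesis
    using val_ge_bound_orbit[OF orbit_C' t_pos ps] eq by simp
qed

text \<open>For the line of play where Dominator makes two cycle moves in succession because Staller
  answers in the clique.\<close>

lemma valD_Z_two_edges:
  assumes "x \<in> Z" "h' \<in> H" "\<exists>y\<in>Z. h' \<inter> Z = {y, s y}"
  shows "4 * t - 1 \<le> valD (Z - {x, s x} - h')"
proof -
  from split_orbits[OF assms(1)] obtain K K' where K: "x \<in> K" "orbit (3 * t + 1) K"
    "orbit (3 * t + 1) K'" "Z = K \<union> K'" "K \<inter> K' = {}" .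
  let ?Ls = "[chain x 2 (3 * t + 1)]"
  have ps: "path_system ?Ls" and pts: "pts ?Ls = K - {x, s x}"
    using orbit_open[OF K(2) _ path_system_Nil _ K(1)] t_pos by simp_all
  have bD: "boundD ?Ls + 1 = 2 * t" using boundD_open[OF t_pos, of x "[]"] by simp
  have bS: "boundS ?Ls = 2 * t" using boundS_open[OF t_pos, of x "[]"] by simp
  have "s x \<in> K" using orbit_funpow[OF K(2,1), of 1] by simp
  then have eq: "Z - {x, s x} = K' \<union> pts ?Ls" using pts K by blast
  obtain y where y: "y \<in> Z" "h' \<inter> Z = {y, s y}" using assms by blast
  show ?thesis
  proof (cases "y \<in> K")
    case True
    \<comment> \<open>Both edges lie in one cycle. The run left by the first is hot, so the second
      clause of \<open>runs_drop\<close> applies and Dominator may be to move again.\<close>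
    have "odd (runs_hot ?Ls)"
      using bD bS by (auto simp: boundD_def boundS_def elim!: evenE)
    moreover from path_system_reply[OF ps assms(2)] obtain Ls' where
      Ls': "path_system Ls'" "pts Ls' \<subseteq> pts ?Ls - h'" "runs_drop ?Ls Ls'" .
    ultimately have "boundD ?Ls \<le> boundD Ls' + 1" unfolding runs_drop_def by blast
    then have "2 * t \<le> boundD Ls' + 2" using bD by simp
    \<comment> \<open>\<open>boundD Ls'\<close> is at least the even number
      \<open>2 * t - 2\<close>, so rounding down to an even number does no harm.\<close>
    then have "4 * t - 1 \<le> 2 * t + 2 * (boundD Ls' div 2) + 1" by presburger
    also have "\<dots> \<le> valD (K' \<union> pts Ls')"
      using val_ge_bound_orbit[OF K(3) t_pos Ls'(1)] Ls'(2) pts K(5) by blast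
    also have "\<dots> \<le> valD (Z - {x, s x} - h')"
    proof (rule val_mono)
      have "h' \<inter> K \<noteq> {}" using True y by blast
      then have "h' \<inter> K' = {}" using orbit_edge[OF K(2) assms(2)] K(4,5) by blast
      then show "K' \<union> pts Ls' \<subseteq> Z - {x, s x} - h'" using eq Ls'(2) by blast
    qed (use finite_Z in simp)
    finally show ?thesis .
  next
    case False
    \<comment> \<open>The edges lie in different cycles, and both cycles become hot runs of value
      \<open>2 * t - 1\<close>; the two hot runs together contribute one more, in total
      \<open>4 * t - 1\<close>.\<close>
    then have yK: "y \<in> K'" using y K by blast
    have disj: "K' \<inter> pts ?Ls = {}" using pts K(5) by blast
    let ?Ls' = "chain y 2 (3 * t + 1) # ?Ls"
    have ps': "path_system ?Ls'" and set: "set (chain y 2 (3 * t + 1)) = K' - {y, s y}"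
      using orbit_open[OF K(3) _ ps disj yK] t_pos by simp_all
    have "s y \<in> K'" using orbit_funpow[OF K(3) yK, of 1] by simp
    then have "h' \<inter> Z \<subseteq> K'" using y(2) yK by simp
    then have h'Ls: "h' \<inter> pts ?Ls = {}" using disj pts K(4) by blast
    have "K' - h' = K' - h' \<inter> Z" using K(4) by blast
    then have rest: "Z - {x, s x} - h' = pts ?Ls'"
      unfolding eq y(2) pts_simps(2)[of "chain y 2 (3 * t + 1)"] set using h'Ls by blast
    have "boundD ?Ls' + 1 = 4 * t" using boundD_open[OF t_pos, of y ?Ls] bS by simp
    moreover have "boundD ?Ls' \<le> valD (pts ?Ls')" using val_ge_bound[OF ps'] by blast
    ultimately show ?thesis unfolding rest by linarith
  qed
qed

text \<open>Whatever an edge takes from three consecutive vertices, the rest fits into one edge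
  again. The special move is kept away since it could take the middle vertex alone and leave the two
  ends.\<close>

lemma replyable_triple:
  assumes x: "x \<in> Z" and z: "z \<notin> {x, s x, s (s x)}" "s (s z) \<notin> {x, s x, s (s x)}"
  shows "replyable {x, s x, s (s x)}"
  unfolding replyable_def
proof (intro ballI impI)
  let ?T = "{x, s x, s (s x)}"
  fix h assume h: "h \<in> H" "h \<inter> ?T \<noteq> {}"
  have TZ: "?T \<subseteq> Z" using x s_in by simp
  then have hT: "h \<inter> ?T = h \<inter> Z \<inter> ?T" by blast
  then obtain y where y: "y \<in> Z" "h \<inter> Z = {y, s y}"
    using moves[OF h(1)] h(2) z by auto
  have cover: "\<exists>h'\<in>H. {w, s w} \<subseteq> h'" if "w \<in> Z" for w using edge[OF that] by blast
  have "y \<in> ?T \<or> s y = x"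
  proof (rule ccontr)
    assume not: "\<not> ?thesis"
    then have "s y \<in> {s x, s (s x)}" using h(2) hT y(2) by auto
    then have "y = x \<or> y = s x"
      using inj_on_eq_iff[OF inj_s y(1) x] inj_on_eq_iff[OF inj_s y(1) s_in[OF x]] by simp
    then show False using not by blast
  qed
  then consider "y = x" | "y = s x" | "y = s (s x)" | "s y = x" by blast
  then have "\<exists>w\<in>Z. ?T - {y, s y} \<subseteq> {w, s w}"
  proof cases
    case 1 then show ?thesis using x s_in by (intro bexI[of _ "s (s x)"]) auto
  next
    case 2 then show ?thesis using x by (intro bexI[of _ x]) auto
  next
    case 3 then show ?thesis using x by (intro bexI[of _ x]) auto
  next
    case 4 then show ?thesis using x s_in by (intro bexI[of _ "s x"]) auto
  qed
  moreover have "?T - h = ?T - {y, s y}" using TZ y(2) by blast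
  ultimately show "\<exists>h'\<in>H. ?T - h \<subseteq> h'" using cover by (metis order_trans)
qed

lemma replyable_doubleton:
  assumes "x \<in> Z" "y \<in> Z"
  shows "replyable {x, y}"
  unfolding replyable_def
proof (intro ballI impI)
  fix h assume "h \<inter> {x, y} \<noteq> {}"
  then have "{x, y} - h \<subseteq> {y} \<or> {x, y} - h \<subseteq> {x}" by auto
  moreover obtain h1 h2 where "h1 \<in> H" "x \<in> h1" "h2 \<in> H" "y \<in> h2"
    using edge[OF assms(1)] edge[OF assms(2)] by blast
  ultimately show "\<exists>h'\<in>H. {x, y} - h \<subseteq> h'" by blast
qed

definition triple :: "'a \<Rightarrow> nat \<Rightarrow> 'a set" where
  "triple x i = {(s ^^ i) x, (s ^^ Suc i) x, (s ^^ Suc (Suc i)) x}"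

text \<open>Each cycle contributes \<open>2 * t\<close>: \<open>C\<close> without the special pair
  is divided into \<open>t\<close> blocks beforehand, \<open>C'\<close> only once Staller has moved
  there.\<close>

lemma valS_Z_gap: "valS (Z - {z, s (s z)}) \<le> 4 * t"
proof -
  let ?k = "3 * t + 1"
  have CZ: "C \<subseteq> Z" "C' \<subseteq> Z" using Z_eq by auto
  have ssz: "s (s z) \<in> C" using orbit_funpow[OF orbit_C z_C, of 2] by (simp add: numeral_2_eq_2)
  \<comment> \<open>In exponents of \<open>s\<close>, the special pair is 0 and 2. Its outer
    leftovers 1 and \<open>3 * t\<close> form a block although they are not adjacent, and
    \<open>3, ..., 3 * t - 1\<close> split into \<open>t - 1\<close> triples.\<close>
  define Ts where "Ts = {s z, (s ^^ (3 * t)) z} # map (\<lambda>i. triple z (3 * i)) [1..<t]"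
  have repl: "\<forall>T\<in>set Ts. replyable T"
  proof
    fix T assume "T \<in> set Ts"
    then consider "T = {s z, (s ^^ (3 * t)) z}"
      | i where "1 \<le> i" "i < t" "T = triple z (3 * i)"
      by (auto simp: Ts_def)
    then show "replyable T"
    proof cases
      case 1
      have "s z \<in> Z" "(s ^^ (3 * t)) z \<in> Z"
        using orbit_funpow[OF orbit_C z_C, of 1] orbit_funpow[OF orbit_C z_C] CZ by auto
      then show ?thesis using replyable_doubleton 1 by simp
    next
      case (2 i)
      have inj: "inj_on (\<lambda>j. (s ^^ j) z) {0..<?k}"
        using orbitD(4)[OF orbit_C z_C] unfolding chain_def distinct_map set_upt by blast
      have "(s ^^ j) z \<noteq> z \<and> (s ^^ j) z \<noteq> s (s z)"
        if "j \<in> {3 * i, Suc (3 * i), Suc (Suc (3 * i))}" for j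
      proof -
        have "3 \<le> j" "j < ?k" using that 2 by auto
        then have "(s ^^ j) z \<noteq> (s ^^ 0) z" "(s ^^ j) z \<noteq> (s ^^ 2) z"
          using inj_onD[OF inj, of j 0] inj_onD[OF inj, of j 2] by auto
        then show ?thesis by (simp add: numeral_2_eq_2)
      qed
      then have "z \<notin> triple z (3 * i)" "s (s z) \<notin> triple z (3 * i)"
        unfolding triple_def by (metis insertE insertI1 insertI2 singletonD)+
      moreover have "(s ^^ (3 * i)) z \<in> Z" using orbit_funpow[OF orbit_C z_C] CZ by blast
      ultimately show ?thesis
        using replyable_triple[of "(s ^^ (3 * i)) z"] 2(3) by (simp add: triple_def)
    qed
  qed
  have "Z - {z, s (s z)} \<subseteq> C' \<union> \<Union> (set Ts)"
  proof
    fix x assume x: "x \<in> Z - {z, s (s z)}"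
    show "x \<in> C' \<union> \<Union> (set Ts)"
    proof (cases "x \<in> C'")
      case False
      then have "x \<in> set (chain z 0 ?k)" using x Z_eq orbitD(3)[OF orbit_C z_C] by blast
      then obtain j where j: "j < ?k" "x = (s ^^ j) z" unfolding set_chain by blast
      have "j \<noteq> 0" using x j by (intro notI) simp
      moreover have "j \<noteq> 2" using x j by (intro notI) (simp add: numeral_2_eq_2)
      ultimately consider "j = 1" | "j = 3 * t" | "3 \<le> j" "j < 3 * t" using j by linarith
      then show ?thesis
      proof cases
        case 3
        then have "1 \<le> j div 3" "j div 3 < t" by auto
        moreover have "j = 3 * (j div 3) \<or> j = Suc (3 * (j div 3)) \<or> j = Suc (Suc (3 * (j div 3)))"
          by presburger
        then have "x \<in> triple z (3 * (j div 3))" unfolding triple_def j(2) by (metis insertCI)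
        ultimately show ?thesis by (auto simp: Ts_def)
      qed (use j in \<open>auto simp: Ts_def\<close>)
    qed simp
  qed
  moreover have "\<exists>h'\<in>H. \<exists>Fs. C' - h - h' \<subseteq> \<Union> (set Fs) \<and> (\<forall>T\<in>set Fs. replyable T) \<and> length Fs < t"
    if h: "h \<in> H" "h \<inter> C' \<noteq> {}" for h
  proof -
    have hC': "h \<inter> Z \<subseteq> C'" using orbit_edge[OF orbit_C' h] .
    moreover have "h \<inter> Z \<noteq> {}" using h(2) CZ by blast
    ultimately obtain x where x: "x \<in> Z" "h \<inter> Z = {x, s x}"
      using moves[OF h(1)] z_C C_disj by blast
    then have xC: "x \<in> C'" using hC' by blast
    have pow: "(s ^^ j) x \<in> C'" for j using orbit_funpow[OF orbit_C' xC] .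
    \<comment> \<open>Dominator answers with the next edge along the cycle. The exponents
      \<open>4, ..., 3 * t\<close> remain, which make \<open>t - 1\<close> triples.\<close>
    have "(s ^^ 2) x \<in> Z" using pow CZ by blast
    from edge[OF this] obtain h' where h': "h' \<in> H" "h' \<inter> Z = {(s ^^ 2) x, s ((s ^^ 2) x)}" by blast
    let ?Fs = "map (\<lambda>i. triple x (3 * i + 1)) [1..<t]"
    have "C' - h - h' \<subseteq> \<Union> (set ?Fs)"
    proof
      fix y assume y: "y \<in> C' - h - h'"
      then have "y \<in> set (chain x 0 ?k)" using orbitD(3)[OF orbit_C' xC] by blast
      then obtain j where j: "j < ?k" "y = (s ^^ j) x" unfolding set_chain by blast
      have "y \<notin> {(s ^^ 0) x, (s ^^ 1) x, (s ^^ 2) x, (s ^^ 3) x}"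
      proof -
        have "y \<in> Z" using y CZ by blast
        then have "y \<notin> h \<inter> Z" "y \<notin> h' \<inter> Z" using y by blast+
        then show ?thesis unfolding x(2) h'(2) by (auto simp: numeral_2_eq_2 numeral_3_eq_3)
      qed
      then have "j \<notin> {0, 1, 2, 3}" using j(2) by blast
      then have j4: "4 \<le> j" by auto
      let ?i = "(j - 1) div 3"
      have "1 \<le> ?i" "?i < t" using j4 j(1) by auto
      moreover have "j = 3 * ?i + 1 \<or> j = Suc (3 * ?i + 1) \<or> j = Suc (Suc (3 * ?i + 1))"
        using j4 by presburger
      then have "y \<in> triple x (3 * ?i + 1)" unfolding triple_def j(2) by (metis insertCI)
      ultimately show "y \<in> \<Union> (set ?Fs)" by auto
    qed
    moreover have "\<forall>T\<in>set ?Fs. replyable T"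
    proof
      fix T assume "T \<in> set ?Fs"
      then obtain i where i: "T = triple x (3 * i + 1)" by auto
      have "triple x (3 * i + 1) \<subseteq> C'" unfolding triple_def using pow by blast
      then have "z \<notin> triple x (3 * i + 1)" "s (s z) \<notin> triple x (3 * i + 1)"
        using z_C ssz C_disj by blast+
      moreover have "(s ^^ (3 * i + 1)) x \<in> Z" using pow CZ by blast
      ultimately show "replyable T"
        using replyable_triple[of "(s ^^ (3 * i + 1)) x"] i by (simp add: triple_def)
    qed
    ultimately show ?thesis using h'(1) t_pos by (intro bexI[of _ h'] exI[of _ ?Fs]) auto
  qed
  ultimately have "valS (Z - {z, s (s z)}) \<le> 2 * length Ts + 2 * t"
    using valS_le_replyable_plus[of C' t "Z - {z, s (s z)}" Ts] repl finite_Z by simp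
  then show ?thesis using t_pos by (simp add: Ts_def)
qed

end

section \<open>The cycle with an attached clique\<close>

locale cycle_clique =
  fixes n m t :: nat
  assumes n_eq: "n = 6 * t + 2" and t_pos: "t > 0" and m_ge: "m \<ge> 4"
begin

lemma n_ge: "n \<ge> 8"
  using n_eq t_pos by simp

abbreviation "G \<equiv> cycle_clique_graph n m"
abbreviation "K \<equiv> clique_verts m"

text \<open>The two cycle neighbors of \<open>U (i + 1)\<close> are \<open>U i\<close> and
  \<open>U (i + 2)\<close>, indices modulo \<open>n\<close>; with this step as \<open>s\<close>,
  open neighborhoods on the cycle become edges.\<close>

definition next_opposite :: "vertex \<Rightarrow> vertex" where
  "next_opposite x = (case x of U i \<Rightarrow> U (if i + 2 \<le> n then i + 2 else i + 2 - n) | _ \<Rightarrow> x)"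

definition cycle_half :: "nat \<Rightarrow> vertex set" where
  "cycle_half p = (\<lambda>a. U (2 * a + p)) ` {0..<3 * t + 1}"

abbreviation "Z \<equiv> U ` {1..n}"

lemma next_opposite_U [simp]: "next_opposite (U i) = U (if i + 2 \<le> n then i + 2 else i + 2 - n)"
  by (simp add: next_opposite_def)

lemma K_no_U [simp]: "U i \<notin> K"
  by (auto simp: clique_verts_def)

lemma in_K: "W 1 \<in> K" "W 2 \<in> K" "V 1 \<in> K" "V 2 \<in> K"
  using m_ge by (auto simp: clique_verts_def)

lemma verts_G: "verts G = Z \<union> K"
  by (simp add: cycle_clique_graph_def)

lemma finite_verts_G: "finite (verts G)"
  unfolding verts_G by (simp add: clique_verts_def)

section \<open>Adjacency and open neighborhoods\<close>

lemma edge_UU: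
  "{U i, U j} \<in> edges G \<longleftrightarrow>
     1 \<le> i \<and> i < n \<and> j = i + 1 \<or> 1 \<le> j \<and> j < n \<and> i = j + 1 \<or> i = n \<and> j = 1 \<or> i = 1 \<and> j = n"
  unfolding cycle_clique_graph_def ugraph.simps Un_iff mem_Collect_eq
  by (auto simp: doubleton_eq_iff)

lemma edge_UK:
  assumes "x \<in> K"
  shows "{U i, x} \<in> edges G \<longleftrightarrow> i \<in> {1, 5} \<and> x \<in> {W 1, W 2}"
  using assms unfolding cycle_clique_graph_def ugraph.simps Un_iff mem_Collect_eq
  by (auto simp: doubleton_eq_iff)

lemma edge_KK:
  assumes "x \<in> K" "y \<in> K"
  shows "{x, y} \<in> edges G \<longleftrightarrow> x \<noteq> y"
proof
  assume "{x, y} \<in> edges G"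
  then have "card {x, y} = 2"
    using simple_graph_cycle_clique_graph[of n m] n_eq t_pos by (simp add: simple_graph_def)
  then show "x \<noteq> y" by auto
next
  assume "x \<noteq> y"
  then show "{x, y} \<in> edges G"
    using assms unfolding cycle_clique_graph_def ugraph.simps by blast
qed

lemma neighbors_V: "V a \<in> K \<Longrightarrow> neighbors G (V a) = K - {V a}"
  unfolding neighbors_def verts_G
  using edge_UK[of "V a"] edge_KK[of "V a"] by (auto simp: insert_commute)

lemma neighbors_W:
  assumes "W a \<in> K"
  shows "neighbors G (W a) = (K - {W a}) \<union> {U 1, U 5}"
proof -
  have "a = 1 \<or> a = 2" using assms by (auto simp: clique_verts_def)
  moreover have "{U 1, U 5} \<subseteq> Z" using n_ge by auto
  ultimately show ?thesis
    unfolding neighbors_def verts_G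
    using assms edge_UK[of "W a"] edge_KK[of "W a"] by (auto simp: insert_commute)
qed

lemma neighbors_U_clique: "neighbors G (U i) \<inter> K \<subseteq> {W 1, W 2}"
  unfolding neighbors_def using edge_UK by blast

text \<open>Indexing by the preceding vertex \<open>U a\<close> makes \<open>U 1\<close> the case
  \<open>a = n\<close>, with cycle neighbors \<open>U n\<close> and \<open>U 2\<close>.\<close>

lemma neighbors_U:
  assumes "1 \<le> a" "a \<le> n"
  shows "neighbors G (U (if a < n then a + 1 else 1)) \<inter> Z = {U a, next_opposite (U a)}"
  unfolding neighbors_def verts_G using assms n_ge by (auto simp: edge_UU image_iff)

lemma neighbors_U_ex:
  assumes "1 \<le> i" "i \<le> n"
  shows "\<exists>x\<in>Z. neighbors G (U i) \<inter> Z = {x, next_opposite x}"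
proof -
  obtain a where a: "1 \<le> a" "a \<le> n" "i = (if a < n then a + 1 else 1)"
  proof (cases "i = 1")
    case True
    then show thesis using that[of n] n_ge by simp
  next
    case False
    then show thesis using that[of "i - 1"] assms by simp
  qed
  then have "U a \<in> Z" by auto
  then show ?thesis using neighbors_U[OF a(1,2)] unfolding a(3) by blast
qed

text \<open>In the coordinate \<open>a\<close> of \<open>cycle_half p\<close> the map is the shift
  by one modulo \<open>3 t + 1\<close>, which makes the odd half (\<open>p = 1\<close>) and the even
  half (\<open>p = 2\<close>) single cycles.\<close>

lemma funpow_next_opposite:
  assumes "p = 1 \<or> p = 2" "a < 3 * t + 1"
  shows "(next_opposite ^^ j) (U (2 * a + p)) = U (2 * ((a + j) mod (3 * t + 1)) + p)"
proof (induction j)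
  case (Suc j)
  let ?b = "(a + j) mod (3 * t + 1)"
  have "?b < 3 * t + 1" by simp
  then have "2 * ?b + p + 2 \<le> n \<longleftrightarrow> Suc ?b \<noteq> 3 * t + 1"
    using assms(1) unfolding n_eq by linarith
  moreover have "(a + Suc j) mod (3 * t + 1) = (if Suc ?b = 3 * t + 1 then 0 else Suc ?b)"
    by (simp only: add_Suc_right mod_Suc)
  moreover have "2 * ?b + p + 2 - n = p" if "Suc ?b = 3 * t + 1"
    using that unfolding n_eq by linarith
  ultimately show ?case
    unfolding funpow.simps comp_def Suc.IH by simp
qed (use assms in simp)

lemma mod_add_cancel:
  fixes a i j k :: nat
  assumes "(a + i) mod k = (a + j) mod k" "i < k" "j < k"
  shows "i = j"
  using assms cong_add_lcancel_nat[of a i j k] by (simp add: cong_def)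

abbreviation "gap \<equiv> {U 1, U 5}"

lemma gap_eq: "{U 1, next_opposite (next_opposite (U 1))} = gap"
  using n_ge by (simp add: eval_nat_numeral)

lemma Z_K [simp]: "Z \<inter> K = {}"
  by auto

lemma gap_Z: "gap \<subseteq> Z"
  using n_ge by auto

lemma clique_cases:
  assumes "v \<in> verts G"
  obtains (U) i x where "v = U i" "x \<in> Z" "neighbors G v \<inter> Z = {x, next_opposite x}"
    | (W) a where "v = W a" "W a \<in> K" "neighbors G v = (K - {W a}) \<union> gap"
    | (V) a where "v = V a" "V a \<in> K" "neighbors G v = K - {V a}"
proof (cases v)
  case v: (U i)
  then have "1 \<le> i" "i \<le> n" using assms unfolding verts_G by auto
  from neighbors_U_ex[OF this] obtain x where "x \<in> Z" "neighbors G v \<inter> Z = {x, next_opposite x}"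
    unfolding v by blast
  then show thesis using U v by blast
next
  case v: (W a)
  then have "W a \<in> K" using assms unfolding verts_G by auto
  then show thesis using W v neighbors_W by blast
next
  case v: (V a)
  then have "V a \<in> K" using assms unfolding verts_G by auto
  then show thesis using V v neighbors_V by blast
qed

sublocale two_orbits "neighbors G ` verts G" Z next_opposite "U 1" "cycle_half 1" "cycle_half 2" t
proof -
  have orb: "path_covering.orbit Z next_opposite (3 * t + 1) (cycle_half p)"
    if pc: "path_covering (neighbors G ` verts G) Z next_opposite (U 1)" and p: "p = 1 \<or> p = 2" for p
  proof -
    interpret path_covering "neighbors G ` verts G" Z next_opposite "U 1" by (fact pc)
    let ?k = "3 * t + 1"
    have card: "card (cycle_half p) = ?k"
      unfolding cycle_half_def by (subst card_image) (auto simp: inj_on_def)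
    show ?thesis
      unfolding orbit_def
    proof (intro conjI ballI)
      show "cycle_half p \<noteq> {}" by (simp add: cycle_half_def)
      show "cycle_half p \<subseteq> Z" using p n_eq by (auto simp: cycle_half_def)
      fix x assume "x \<in> cycle_half p"
      then obtain a where a: "a < ?k" "x = U (2 * a + p)" by (auto simp: cycle_half_def)
      have ch: "chain x 0 ?k = map (\<lambda>j. U (2 * ((a + j) mod ?k) + p)) [0..<?k]"
        unfolding chain_def a(2) using funpow_next_opposite[OF p a(1)] by simp
      show dist: "distinct (chain x 0 ?k)"
        unfolding ch distinct_map set_upt
      proof (intro conjI inj_onI)
        fix i j assume "i \<in> {0..<?k}" "j \<in> {0..<?k}"
          "U (2 * ((a + i) mod ?k) + p) = U (2 * ((a + j) mod ?k) + p)"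
        then show "i = j" by (intro mod_add_cancel[of a i ?k j]) simp_all
      qed simp
      have "set (chain x 0 ?k) \<subseteq> cycle_half p"
        unfolding ch cycle_half_def by auto
      moreover have "card (set (chain x 0 ?k)) = ?k"
        using distinct_card[OF dist] by simp
      ultimately show "cycle_half p = set (chain x 0 ?k)"
        using card by (metis card_subset_eq card.infinite finite_set add_is_0 zero_neq_one)
      show "(next_opposite ^^ ?k) x = x"
        unfolding a(2) funpow_next_opposite[OF p a(1)] using a(1) by (simp only: mod_add_self2 mod_less)
    qed
  qed
  have pc: "path_covering (neighbors G ` verts G) Z next_opposite (U 1)"
  proof
    show "finite (neighbors G ` verts G)" using finite_verts_G by simp
    show "inj_on next_opposite Z" by (auto simp: inj_on_def split: if_splits)
    show "next_opposite x \<in> Z" if "x \<in> Z" for x using that n_ge by (auto simp: image_iff)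
    show "U 1 \<in> Z" using n_ge by auto
    show "\<exists>h\<in>neighbors G ` verts G. h \<inter> Z = {x, next_opposite x}" if x: "x \<in> Z" for x
    proof -
      obtain a where a: "x = U a" "1 \<le> a" "a \<le> n" using x by auto
      have "U (if a < n then a + 1 else 1) \<in> verts G" unfolding verts_G using a by auto
      then show ?thesis using neighbors_U[OF a(2,3)] a(1) by blast
    qed
    show "h \<inter> Z = {} \<or> h \<inter> Z = {U 1, next_opposite (next_opposite (U 1))} \<or>
        (\<exists>x\<in>Z. h \<inter> Z = {x, next_opposite x})" if h: "h \<in> neighbors G ` verts G" for h
    proof -
      obtain v where v: "v \<in> verts G" "h = neighbors G v" using h by blast
      from v(1) show ?thesis
      proof (cases v rule: clique_cases)
        case (W a)
        then have "h \<inter> Z = gap" using v Z_K gap_Z by blast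
        then show ?thesis unfolding gap_eq by blast
      next
        case (V a)
        then have "h \<inter> Z = {}" using v Z_K by blast
        then show ?thesis by blast
      qed (use v in blast)
    qed
  qed simp
  have "Z = cycle_half 1 \<union> cycle_half 2"
  proof (intro equalityI subsetI)
    fix x assume "x \<in> Z"
    then obtain i where i: "x = U i" "1 \<le> i" "i \<le> n" by auto
    have "i = 2 * ((i - 1) div 2) + 1 \<or> i = 2 * ((i - 1) div 2) + 2" "(i - 1) div 2 < 3 * t + 1"
      using i n_eq by presburger+
    then show "x \<in> cycle_half 1 \<union> cycle_half 2" unfolding i(1) cycle_half_def by auto
  qed (use n_eq in \<open>auto simp: cycle_half_def\<close>)
  moreover have "cycle_half 1 \<inter> cycle_half 2 = {}" unfolding cycle_half_def by auto presburger
  moreover have "U 1 \<in> cycle_half 1" unfolding cycle_half_def by (auto intro!: image_eqI[of _ _ 0])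
  ultimately show "two_orbits (neighbors G ` verts G) Z next_opposite (U 1) (cycle_half 1) (cycle_half 2) t"
    using pc orb[OF pc] t_pos by (simp add: two_orbits_def two_orbits_axioms_def)
qed

text \<open>Staller plays \<open>V a\<close>, which covers the whole clique except
  \<open>V a\<close> itself and does not touch the cycle. This is how she hands the turn on the
  cycle to Dominator.\<close>

lemma valS_clique_ge:
  assumes A: "A \<subseteq> Z" "B \<subseteq> K" and V: "V a \<in> K" "B - {V a} \<noteq> {}"
  shows "1 + valD (A \<union> (B \<inter> {V a})) \<le> valS (A \<union> B)"
proof -
  let ?h = "neighbors G (V a)"
  have h: "?h = K - {V a}" using neighbors_V V(1) by blast
  have "finite (A \<union> B)" using A finite_verts_G unfolding verts_G by (meson finite_subset Un_mono)
  moreover have "?h \<in> neighbors G ` verts G" using V(1) unfolding verts_G by blast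
  moreover have "?h \<inter> (A \<union> B) \<noteq> {}" using h A V by blast
  ultimately have "1 + valD (A \<union> B - ?h) \<le> valS (A \<union> B)" by (rule valS_ge)
  moreover have "A \<union> B - ?h = A \<union> (B \<inter> {V a})" unfolding h using A Z_K by blast
  ultimately show ?thesis by simp
qed

section \<open>Staller's bound on the whole graph\<close>

lemma V_other: obtains b where "V b \<in> K" "b \<noteq> a"
  using in_K(3,4) by (metis one_eq_numeral_iff num.distinct(1))

text \<open>The position after Dominator opens with an edge and Staller replies with
  \<open>V 1\<close>: of the clique only \<open>V 1\<close> is undominated, and it still costs one
  move.\<close>

lemma valD_edge_V:
  assumes x: "x \<in> Z"
  shows "4 * t + 1 \<le> valD ((Z - {x, next_opposite x}) \<union> {V 1})"
proof -
  let ?e = "{x, next_opposite x}"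
  let ?Q = "(Z - ?e) \<union> {V 1}"
  obtain hx where hx: "hx \<in> neighbors G ` verts G" "hx \<inter> Z = ?e" using edge[OF x] by blast
  have finQ: "finite ?Q" by simp
  have legal: "neighbors G (V 2) \<in> neighbors G ` verts G" "neighbors G (V 2) \<inter> ?Q \<noteq> {}"
    using in_K neighbors_V[of 2] unfolding verts_G by auto
  show ?thesis
  proof (rule valD_ge[OF finQ legal])
    fix h assume h: "h \<in> neighbors G ` verts G" "h \<inter> ?Q \<noteq> {}"
    then obtain v where v: "v \<in> verts G" "h = neighbors G v" by blast
    have "4 * t \<le> valS (?Q - h)"
      using v(1)
    proof (cases v rule: clique_cases)
      case (U i y)
      have "V 1 \<notin> h" using neighbors_U_clique[of i] in_K U v by blast
      then have eq: "?Q - h = (Z - ?e - h) \<union> {V 1}" by blast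
      \<comment> \<open>A second cycle move is answered by \<open>V 2\<close>, which covers
        \<open>V 1\<close> and supplies the missing move.\<close>
      have "4 * t - 1 \<le> valD (Z - ?e - h)"
        using valD_Z_two_edges[OF x h(1)] U v by blast
      moreover have "1 + valD ((Z - ?e - h) \<union> ({V 1} \<inter> {V 2})) \<le> valS ((Z - ?e - h) \<union> {V 1})"
        using in_K by (intro valS_clique_ge) auto
      ultimately show ?thesis unfolding eq by simp
    next
      case (W a)
      then have eq: "?Q - h = Z - gap - hx"
        using v in_K hx(2) Z_K by blast
      \<comment> \<open>The order of moves is irrelevant: this is also the position after Dominator
        plays \<open>hx\<close> on \<open>Z - gap\<close>. The next case argues likewise with
        \<open>Z\<close>.\<close>
      have "valD (Z - gap) \<le> 1 + valS (Z - gap - hx)"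
        by (rule valD_le_any) (use hx in auto)
      then show ?thesis unfolding eq using valD_Z_gap unfolding gap_eq by linarith
    next
      case (V a)
      then have "a \<noteq> 1" using h v Z_K by blast
      then have eq: "?Q - h = Z - hx"
        using V v in_K hx(2) Z_K by blast
      have "valD Z \<le> 1 + valS (Z - hx)"
        by (rule valD_le_any) (use hx in auto)
      then show ?thesis unfolding eq using valD_Z by linarith
    qed
    then show "4 * t + 1 \<le> 1 + valS (?Q - h)" by simp
  qed
qed

text \<open>Staller always replies with some \<open>V b\<close>. After a cycle move both
  \<open>V 1\<close> and \<open>V 2\<close> are undominated, and playing \<open>V 1\<close> leaves
  \<open>V 1\<close> itself for later; after a clique move the single vertex left there is covered
  at once.\<close>

lemma valD_verts_ge: "4 * t + 3 \<le> valD (Z \<union> K)"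
proof -
  have fin: "finite (Z \<union> K)" using finite_verts_G unfolding verts_G .
  have legal: "neighbors G (V 1) \<in> neighbors G ` verts G" "neighbors G (V 1) \<inter> (Z \<union> K) \<noteq> {}"
    using in_K neighbors_V[of 1] unfolding verts_G by auto
  show ?thesis
  proof (rule valD_ge[OF fin legal])
    fix h assume "h \<in> neighbors G ` verts G"
    then obtain v where v: "v \<in> verts G" "h = neighbors G v" by blast
    have "4 * t + 2 \<le> valS (Z \<union> K - h)"
      using v(1)
    proof (cases v rule: clique_cases)
      case (U i x)
      let ?e = "{x, next_opposite x}"
      have hK: "h \<inter> K \<subseteq> {W 1, W 2}" using neighbors_U_clique[of i] U v by blast
      have "h \<inter> Z = ?e" using U v by blast
      then have eq: "Z \<union> K - h = (Z - ?e) \<union> (K - h)" using Z_K by blast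
      have V: "V 1 \<in> K - h" "V 2 \<in> K - h" using hK in_K by auto
      have "1 + valD ((Z - ?e) \<union> ((K - h) \<inter> {V 1})) \<le> valS ((Z - ?e) \<union> (K - h))"
        using V in_K by (intro valS_clique_ge) auto
      moreover have "(K - h) \<inter> {V 1} = {V 1}" using V by blast
      ultimately show ?thesis unfolding eq using valD_edge_V[OF U(2)] by simp
    next
      case (W a)
      then have eq: "Z \<union> K - h = (Z - gap) \<union> {W a}" using v Z_K gap_Z by blast
      have "1 + valD ((Z - gap) \<union> ({W a} \<inter> {V 1})) \<le> valS ((Z - gap) \<union> {W a})"
        using W in_K by (intro valS_clique_ge) auto
      then show ?thesis unfolding eq using valD_Z_gap unfolding gap_eq by simp
    next
      case (V a)
      then have eq: "Z \<union> K - h = Z \<union> {V a}" using v Z_K by blast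
      obtain b where b: "V b \<in> K" "b \<noteq> a" by (rule V_other)
      have "1 + valD (Z \<union> ({V a} \<inter> {V b})) \<le> valS (Z \<union> {V a})"
        using V b by (intro valS_clique_ge) auto
      then show ?thesis unfolding eq using valD_Z b(2) by simp
    qed
    then show "4 * t + 3 \<le> 1 + valS (Z \<union> K - h)" by simp
  qed
qed

text \<open>Dominator opens with \<open>W 1\<close>: its neighborhood is the rest of the clique and
  \<open>gap\<close>, while \<open>W 1\<close> itself is predominated, so one move finishes the
  clique.\<close>

lemma valD_predominated_le: "valD (Z \<union> K - {W 1}) \<le> 4 * t + 1"
proof -
  let ?h = "neighbors G (W 1)"
  have "finite (Z \<union> K - {W 1})" using finite_verts_G unfolding verts_G by simp
  moreover have "?h \<in> neighbors G ` verts G" using in_K unfolding verts_G by blast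
  ultimately have "valD (Z \<union> K - {W 1}) \<le> 1 + valS (Z \<union> K - {W 1} - ?h)" by (rule valD_le_any)
  moreover have "Z \<union> K - {W 1} - ?h = Z - gap"
    unfolding neighbors_W[OF in_K(1)] using Z_K in_K(1) by blast
  ultimately show ?thesis using valS_Z_gap unfolding gap_eq by simp
qed

lemma game_numbers:
  "game_total_domination_number G {} = 4 * t + 3"
  "game_total_domination_number G {W 1} = 4 * t + 1"
proof -
  have eq: "game_total_domination_number G S = valD (Z \<union> K - S)" for S
  proof -
    have "{w \<in> verts G. \<not> totally_dominated G S {} w} = Z \<union> K - S"
      unfolding totally_dominated_def verts_G by auto
    then show ?thesis
      unfolding game_total_domination_number_def remaining_moves_eq_cover_game[OF finite_verts_G]
      by simp
  qed
  have fin: "finite (Z \<union> K)" using finite_verts_G unfolding verts_G .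
  \<comment> \<open>The lower bound \<open>4 t + 3\<close> and the upper bound
    \<open>4 t + 1\<close> differ by exactly the 2 that \<open>val_insert_le\<close> allows, so both
    are attained.\<close>
  have "insert (W 1) (Z \<union> K - {W 1}) = Z \<union> K" using in_K by blast
  then have "valD (Z \<union> K) \<le> valD (Z \<union> K - {W 1}) + 2"
    using val_insert_le[of "Z \<union> K - {W 1}" Dominator "W 1"] fin by simp
  then show "game_total_domination_number G {} = 4 * t + 3"
    "game_total_domination_number G {W 1} = 4 * t + 1"
    unfolding eq using valD_verts_ge valD_predominated_le by simp_all
qed

end

theorem theorem2p2:
  fixes n m :: nat
  assumes "n \<ge> 8" and "m \<ge> 4" and "[n = 2] (mod 6)"
  shows "real (game_total_domination_number (cycle_clique_graph n m) {}) = (2 * real n - 1) / 3 + 2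
       \<and> real (game_total_domination_number (cycle_clique_graph n m) {W 1}) = (2 * real n - 1) / 3"
proof -
  have "n mod 6 = 2" using assms(3) by (simp add: cong_def)
  then have n: "n = 6 * (n div 6) + 2" by presburger
  define t where "t = n div 6"
  \<comment> \<open>\<open>n\<close> being at least 8 rules out \<open>t = 0\<close>, and
    \<open>n = 6 t + 2\<close> turns \<open>(2 n - 1) / 3\<close> into
    \<open>4 t + 1\<close>.\<close>
  interpret cycle_clique n m t
    using n assms by unfold_locales (auto simp: t_def)
  show ?thesis
    unfolding game_numbers using n_eq by simp
qed

end
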